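(* For a barotropic Korteweg fluid with a pressure law of van der Waals type, there is a non-trivial one-parameter family $$\left((\underline\nu,\underline U^0,\underline U^1)(m),\ (\overline\nu,\overline U^0,\overline U^1)(m)\right),\qquad 0\le m<\bar m,$$ of pairs of non-identical states such that for every value of the parameter $m$ the Euler–Korteweg system $$\bar T^{\alpha\beta}{}_{,\beta}=0,\qquad \bar T^{\alpha\beta}=\bar\rho\, U^\alpha U^\beta+\bar p\,\Pi^{\alpha\beta}+\kappa(\nu)\,\nu^{,\alpha}\nu^{,\beta},$$ has two heteroclinic solutions $(\nu,U^0,U^1,U^2,U^3)$ depending only on $x^1$, $$x^1\mapsto(\overrightarrow\nu_m(x^1),\overrightarrow U^0_m(x^1),\overrightarrow U^1_m(x^1),0,0),\qquad x^1\mapsto(\overleftarrow\nu_m(x^1),\overleftarrow U^0_m(x^1),\overleftarrow U^1_m(x^1),0,0),$$ with $$(\overrightarrow\nu_m,\overrightarrow U^0_m,\overrightarrow U^1_m)(-\infty)=(\underline\nu,\underline U^0,\underline U^1)(m),\qquad(\overrightarrow\nu_m,\overrightarrow U^0_m,\overrightarrow U^1_m)(+\infty)=(\overline\nu,\overline U^0,\overline U^1)(m),$$ and $$(\overleftarrow\nu_m,\overleftarrow U^0_m,\overleftarrow U^1_m)(-\infty)=(\overline\nu,\overline U^0,\overline U^1)(m),\qquad(\overleftarrow\nu_m,\overleftarrow U^0_m,\overleftarrow U^1_m)(+\infty)=(\underline\nu,\underline U^0,\underline U^1)(m).$$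
   Context: Space-time is Minkowski space with metric $g=\mathrm{diag}(-1,1,1,1)$; Greek indices run over $0,1,2,3$, are raised and lowered with $g$, repeated indices are summed, and $_{,\beta}$ denotes $\partial/\partial x^\beta$. The unknowns are a scalar field $\nu>0$ and the 4-velocity $U^\alpha$ with $U^\alpha U_\alpha=-1$ (and $U^0>0$); $\Pi^{\alpha\beta}=g^{\alpha\beta}+U^\alpha U^\beta$. The fluid is described by a smooth function $r$ on $(0,\infty)$ (energy density $\rho=r(\nu)$) with $r>0$ and $\nu r'(\nu)>r(\nu)$; the pressure is $p=\hat p(\rho)$ with $\hat p(r(\nu))=\check p(\nu)=\nu r'(\nu)-r(\nu)$. The pressure law is of van der Waals type if there are $\nu_B>\nu_A>0$ such that $r''(\nu)>0$ for $0<\nu<\nu_A$ and for $\nu>\nu_B$, while $r''(\nu)<0$ for $\nu_A<\nu<\nu_B$. The capillarity coefficient $\kappa=\kappa(\nu)$ is a smooth positive function. Extended energy and extended pressure: $$\bar\rho(\nu,\partial\nu)=r(\nu)+\tfrac12\kappa(\nu)\nu_{,\gamma}\nu^{,\gamma},\qquad \bar p=\nu\,\frac{\delta\bar\rho}{\delta\nu}-\bar\rho,\qquad \frac{\delta\bar\rho}{\delta\nu}=\frac{\partial\bar\rho}{\partial\nu}-\left(\frac{\partial\bar\rho}{\partial\nu_{,\gamma}}\right)_{,\gamma}.$$ Solutions are smooth; heteroclinic means that the solution converges for $x^1\to\pm\infty$ to end states that differ from each other, and values at $\pm\infty$ denote these limits.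
   Formalization: Assumes in addition that some ν>ν_B lies on the convex envelope of r (the tangent of r there stays below r on (0,∞)); without this the claim fails, e.g. when the pressure tends at infinity to a limit only slightly above its value at ν_B. *)

theory Defs
  imports "HOL-Analysis.Analysis"
begin

(* The numeral type 4 has exactly the elements 0, 1, 2, 3 (with 4 = 0), so components of
   a vector of type real^4 carry the usual space-time indices. *)

type_synonym spacetime = "real^4"

(* diag(-1,1,1,1) is its own inverse, so this is both the covariant and the contravariant
   metric, and multiplication by it both raises and lowers an index. *)
definition minkowski :: "real^4^4"
  where "minkowski = (\<chi> \<alpha> \<beta>. if \<alpha> = \<beta> then (if \<alpha> = 0 then - 1 else 1) else 0)"

definition mink_prod :: "real^4 \<Rightarrow> real^4 \<Rightarrow> real"
  where "mink_prod v w = (\<Sum>\<alpha>\<in>UNIV. \<Sum>\<beta>\<in>UNIV. minkowski $ \<alpha> $ \<beta> * v $ \<alpha> * w $ \<beta>)"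

definition partial :: "4 \<Rightarrow> (real^4 \<Rightarrow> real) \<Rightarrow> real^4 \<Rightarrow> real"
  where "partial \<beta> f x = deriv (\<lambda>t. f (x + t *\<^sub>R axis \<beta> 1)) 0"

definition grad :: "(real^4 \<Rightarrow> real) \<Rightarrow> real^4 \<Rightarrow> real^4"
  where "grad f x = (\<chi> \<beta>. partial \<beta> f x)"

(* C-infinity: every iterated partial derivative is (totally) differentiable everywhere. *)
definition smooth_field :: "(spacetime \<Rightarrow> real) \<Rightarrow> bool"
  where "smooth_field f \<longleftrightarrow> (\<forall>\<beta>s :: 4 list. \<forall>x. foldr partial \<beta>s f differentiable (at x))"

definition smooth_on_pos :: "(real \<Rightarrow> real) \<Rightarrow> bool"
  where "smooth_on_pos f \<longleftrightarrow> (\<forall>k. (deriv ^^ k) f differentiable_on {0<..})"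


(* The positivity of \<nu> r'(\<nu>) - r(\<nu>) says that the pressure is positive; as r > 0 it also
   gives r' > 0, so that the pressure is indeed a function of the energy density r(\<nu>). *)
definition barotropic_fluid :: "(real \<Rightarrow> real) \<Rightarrow> bool"
  where "barotropic_fluid r \<longleftrightarrow>
    smooth_on_pos r \<and> (\<forall>\<nu>>0. r \<nu> > 0 \<and> \<nu> * deriv r \<nu> > r \<nu>)"

definition capillarity_coefficient :: "(real \<Rightarrow> real) \<Rightarrow> bool"
  where "capillarity_coefficient \<kappa> \<longleftrightarrow> smooth_on_pos \<kappa> \<and> (\<forall>\<nu>>0. \<kappa> \<nu> > 0)"

definition van_der_waals :: "(real \<Rightarrow> real) \<Rightarrow> real \<Rightarrow> real \<Rightarrow> bool"
  where "van_der_waals r \<nu>A \<nu>B \<longleftrightarrow> 0 < \<nu>A \<and> \<nu>A < \<nu>B \<and>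
    (\<forall>\<nu>. 0 < \<nu> \<and> \<nu> < \<nu>A \<longrightarrow> deriv (deriv r) \<nu> > 0) \<and>
    (\<forall>\<nu>. \<nu>A < \<nu> \<and> \<nu> < \<nu>B \<longrightarrow> deriv (deriv r) \<nu> < 0) \<and>
    (\<forall>\<nu>. \<nu>B < \<nu> \<longrightarrow> deriv (deriv r) \<nu> > 0)"

(* Some state of the dense phase lies on the convex envelope of the energy.  This does not
   follow from the sign pattern of r'': if the pressure \<nu> r'(\<nu>) - r(\<nu>) tends, as \<nu> tends to
   infinity, to a finite limit that exceeds its value at \<nu>B only slightly, then the tangent of
   r at any \<nu> > \<nu>B lies above r somewhere in the dilute phase, no two distinct states with equal
   pressure and equal r' exist, and there is no static phase boundary.  The property holds
   whenever the pressure attains its value at \<nu>A again at some \<nu> > \<nu>B, in particular if the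
   pressure is unbounded. *)
definition dense_phase_attainable :: "(real \<Rightarrow> real) \<Rightarrow> real \<Rightarrow> bool"
  where "dense_phase_attainable r \<nu>B \<longleftrightarrow>
    (\<exists>\<nu>>\<nu>B. \<forall>\<nu>'>0. r \<nu> + deriv r \<nu> * (\<nu>' - \<nu>) \<le> r \<nu>')"


(* Extended energy as a function of a value n of the field and a value p of its
   (covariant) gradient. *)
definition ext_energy :: "(real \<Rightarrow> real) \<Rightarrow> (real \<Rightarrow> real) \<Rightarrow> real \<Rightarrow> real^4 \<Rightarrow> real"
  where "ext_energy r \<kappa> n p = r n + 1/2 * \<kappa> n * mink_prod p p"

definition variational_derivative ::
    "(real \<Rightarrow> real^4 \<Rightarrow> real) \<Rightarrow> (spacetime \<Rightarrow> real) \<Rightarrow> spacetime \<Rightarrow> real"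
  where "variational_derivative L \<nu> x =
    deriv (\<lambda>n. L n (grad \<nu> x)) (\<nu> x)
    - (\<Sum>\<gamma>\<in>UNIV. partial \<gamma> (\<lambda>y. partial \<gamma> (L (\<nu> y)) (grad \<nu> y)) x)"

definition ext_pressure ::
    "(real \<Rightarrow> real) \<Rightarrow> (real \<Rightarrow> real) \<Rightarrow> (spacetime \<Rightarrow> real) \<Rightarrow> spacetime \<Rightarrow> real"
  where "ext_pressure r \<kappa> \<nu> x =
    \<nu> x * variational_derivative (ext_energy r \<kappa>) \<nu> x - ext_energy r \<kappa> (\<nu> x) (grad \<nu> x)"

definition projector :: "real^4 \<Rightarrow> 4 \<Rightarrow> 4 \<Rightarrow> real"
  where "projector u \<alpha> \<beta> = minkowski $ \<alpha> $ \<beta> + u $ \<alpha> * u $ \<beta>"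

definition korteweg_tensor ::
    "(real \<Rightarrow> real) \<Rightarrow> (real \<Rightarrow> real) \<Rightarrow> (spacetime \<Rightarrow> real) \<Rightarrow> (spacetime \<Rightarrow> real^4)
      \<Rightarrow> 4 \<Rightarrow> 4 \<Rightarrow> spacetime \<Rightarrow> real"
  where "korteweg_tensor r \<kappa> \<nu> U \<alpha> \<beta> x =
    ext_energy r \<kappa> (\<nu> x) (grad \<nu> x) * U x $ \<alpha> * U x $ \<beta>
    + ext_pressure r \<kappa> \<nu> x * projector (U x) \<alpha> \<beta>
    + \<kappa> (\<nu> x) * (minkowski *v grad \<nu> x) $ \<alpha> * (minkowski *v grad \<nu> x) $ \<beta>"

definition euler_korteweg_solution ::
    "(real \<Rightarrow> real) \<Rightarrow> (real \<Rightarrow> real) \<Rightarrow> (spacetime \<Rightarrow> real) \<Rightarrow> (spacetime \<Rightarrow> real^4) \<Rightarrow> bool"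
  where "euler_korteweg_solution r \<kappa> \<nu> U \<longleftrightarrow>
    smooth_field \<nu> \<and> (\<forall>\<alpha>. smooth_field (\<lambda>x. U x $ \<alpha>)) \<and>
    (\<forall>x. \<nu> x > 0 \<and> mink_prod (U x) (U x) = - 1 \<and> U x $ 0 > 0) \<and>
    (\<forall>x \<alpha>. (\<Sum>\<beta>\<in>UNIV. partial \<beta> (korteweg_tensor r \<kappa> \<nu> U \<alpha> \<beta>) x) = 0)"


(* Triples (\<nu>, U^0, U^1) of a state whose components U^2 and U^3 vanish. *)
type_synonym state = "real \<times> real \<times> real"

fun density :: "state \<Rightarrow> real"
  where "density (n, u0, u1) = n"

fun velocity :: "state \<Rightarrow> real^4"
  where "velocity (n, u0, u1) = (\<chi> \<alpha>. if \<alpha> = 0 then u0 else if \<alpha> = 1 then u1 else 0)"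

definition admissible_state :: "state \<Rightarrow> bool"
  where "admissible_state s \<longleftrightarrow>
    density s > 0 \<and> mink_prod (velocity s) (velocity s) = - 1 \<and> velocity s $ 0 > 0"

definition heteroclinic_solution ::
    "(real \<Rightarrow> real) \<Rightarrow> (real \<Rightarrow> real) \<Rightarrow> (real \<Rightarrow> state) \<Rightarrow> state \<Rightarrow> state \<Rightarrow> bool"
  where "heteroclinic_solution r \<kappa> w l h \<longleftrightarrow>
    euler_korteweg_solution r \<kappa> (\<lambda>x. density (w (x $ 1))) (\<lambda>x. velocity (w (x $ 1))) \<and>
    (w \<longlongrightarrow> l) at_bot \<and> (w \<longlongrightarrow> h) at_top \<and> l \<noteq> h"

end

theory Submission
  imports Defs
begin

text \<open>For a stationary profile \<open>u\<close> with \<open>u U\<^sup>1 = m\<close> the system reduces to the planar Hamiltonian equation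
  \<open>\<kappa>(u) u'\<^sup>2 / 2 = W(u)\<close>, \<open>W(n) = r(n) - a sqrt(n\<^sup>2 + m\<^sup>2) + c\<close>.  A heteroclinic orbit between \<open>l\<close> and
  \<open>h\<close> exists in both directions as soon as \<open>W\<close> is positive between \<open>l\<close> and \<open>h\<close> and vanishes there to
  second order, i.e. as soon as a curve \<open>a sqrt(n\<^sup>2 + m\<^sup>2) - c\<close> touches the graph of \<open>r\<close> from below at
  \<open>l\<close> and \<open>h\<close>.  For \<open>m = 0\<close> this is the Maxwell double tangent of a van der Waals energy.  As the
  energy is strictly convex at the two Maxwell states, the double contact survives for small \<open>m\<close>:
  the minima of \<open>r - a sqrt(n\<^sup>2 + m\<^sup>2)\<close> over neighbourhoods of the two states are equal for exactly one
  slope \<open>a\<close>.  Uniqueness of the contact points makes them continuous in \<open>m\<close>.\<close>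

subsection \<open>Smooth functions of one variable\<close>

text \<open>Prescribing the particle flux m and normalising the velocity leaves one unknown
  \<open>u\<close>. For plane fields only the fluxes T^01 and T^11 must be constant: the first
  follows from Bernoulli's law, variational derivative times U^0 equals \<open>a\<close>, the second
  from the first integral. Contact of second order makes sqrt(W) vanish at least linearly, so the
  end states are reached only at infinite time; evenness in \<open>u'\<close> supplies the reversed
  orbit. A double tangent can be lost in two ways: the dense contact point may escape to infinity,
  or the dilute one may run into the vacuum. A state of the dense phase whose tangent stays below
  the energy rules out the first, positivity of the pressure the second. For m > 0 the comparison
  curve is no longer a line. The argument is therefore localised at the two Maxwell states, where a
  lower bound on r'' controls the perturbation, while a uniform gap absorbs it outside. Compactness
  and monotonicity then suffice, with an explicit admissible range of m.\<close>

primrec times_differentiable :: "nat \<Rightarrow> real set \<Rightarrow> (real \<Rightarrow> real) \<Rightarrow> bool" where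
  "times_differentiable 0 S f \<longleftrightarrow> True"
| "times_differentiable (Suc n) S f \<longleftrightarrow>
    (\<exists>f'. (\<forall>x\<in>S. (f has_real_derivative f' x) (at x)) \<and> times_differentiable n S f')"

text \<open>Each level has an existentially quantified derivative in place of an iterate of
  \<open>deriv\<close>. Closure rules then follow by induction, with the usual derivative formula as
  witness.\<close>

definition smooth_on :: "real set \<Rightarrow> (real \<Rightarrow> real) \<Rightarrow> bool"
  where "smooth_on S f \<longleftrightarrow> (\<forall>n. times_differentiable n S f)"

lemma times_differentiable_SucD:
  "times_differentiable (Suc n) S f \<Longrightarrow> times_differentiable n S f"
proof (induction n arbitrary: f)
  case (Suc n)
  then show ?case by (metis times_differentiable.simps(2))
qed simp

lemma times_differentiable_subset:
  "times_differentiable n S f \<Longrightarrow> T \<subseteq> S \<Longrightarrow> times_differentiable n T f"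
proof (induction n arbitrary: f)
  case (Suc n)
  then show ?case unfolding times_differentiable.simps by blast
qed simp

lemma times_differentiable_cong:
  assumes "open S" "\<And>x. x \<in> S \<Longrightarrow> f x = g x" "times_differentiable n S f"
  shows "times_differentiable n S g"
proof (cases n)
  case (Suc k)
  with assms(3) obtain f' where
    f': "\<And>x. x \<in> S \<Longrightarrow> (f has_real_derivative f' x) (at x)" "times_differentiable k S f'"
    unfolding Suc times_differentiable.simps by blast
  have "(g has_real_derivative f' x) (at x)" if "x \<in> S" for x
    using has_field_derivative_transform_within_open[OF f'(1)[OF that] assms(1) that assms(2)] .
  with f'(2) show ?thesis unfolding Suc times_differentiable.simps by blast
qed simp

lemma times_differentiable_const: "times_differentiable n S (\<lambda>x. c)"
proof (induction n arbitrary: c)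
  case (Suc n)
  then show ?case
    using DERIV_const[of c] by (metis times_differentiable.simps(2))
qed simp

lemma times_differentiable_id: "times_differentiable n S (\<lambda>x. x)"
proof (cases n)
  case (Suc k)
  then show ?thesis
    using DERIV_ident times_differentiable_const by (metis times_differentiable.simps(2))
qed simp

lemma times_differentiable_add:
  "times_differentiable n S f \<Longrightarrow> times_differentiable n S g \<Longrightarrow>
    times_differentiable n S (\<lambda>x. f x + g x)"
proof (induction n arbitrary: f g)
  case (Suc n)
  then obtain f' g' where
    f': "\<And>x. x \<in> S \<Longrightarrow> (f has_real_derivative f' x) (at x)" "times_differentiable n S f'" and
    g': "\<And>x. x \<in> S \<Longrightarrow> (g has_real_derivative g' x) (at x)" "times_differentiable n S g'"
    unfolding times_differentiable.simps by blast
  show ?case unfolding times_differentiable.simps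
    using f' g' Suc.IH by (intro exI[of _ "\<lambda>x. f' x + g' x"]) (auto intro: DERIV_add)
qed simp

lemma times_differentiable_mult:
  "times_differentiable n S f \<Longrightarrow> times_differentiable n S g \<Longrightarrow>
    times_differentiable n S (\<lambda>x. f x * g x)"
proof (induction n arbitrary: f g)
  case (Suc n)
  then obtain f' g' where
    f': "\<And>x. x \<in> S \<Longrightarrow> (f has_real_derivative f' x) (at x)" "times_differentiable n S f'" and
    g': "\<And>x. x \<in> S \<Longrightarrow> (g has_real_derivative g' x) (at x)" "times_differentiable n S g'"
    unfolding times_differentiable.simps by blast
  have "times_differentiable n S (\<lambda>x. f' x * g x + f x * g' x)"
    using Suc.prems f' g'
    by (intro times_differentiable_add Suc.IH times_differentiable_SucD[of n S f]
        times_differentiable_SucD[of n S g])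
  then show ?case unfolding times_differentiable.simps
    using f' g' by (intro exI[of _ "\<lambda>x. f' x * g x + f x * g' x"])
      (auto intro!: derivative_eq_intros)
qed simp

lemma times_differentiable_compose:
  "times_differentiable n T f \<Longrightarrow> times_differentiable n S g \<Longrightarrow> g ` S \<subseteq> T \<Longrightarrow>
    times_differentiable n S (\<lambda>x. f (g x))"
proof (induction n arbitrary: f)
  case (Suc n)
  then obtain f' g' where
    f': "\<And>x. x \<in> T \<Longrightarrow> (f has_real_derivative f' x) (at x)" "times_differentiable n T f'" and
    g': "\<And>x. x \<in> S \<Longrightarrow> (g has_real_derivative g' x) (at x)" "times_differentiable n S g'"
    unfolding times_differentiable.simps by blast
  have "times_differentiable n S (\<lambda>x. f' (g x) * g' x)"
    using Suc.prems f' g'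
    by (intro times_differentiable_mult Suc.IH[OF f'(2)] times_differentiable_SucD[of n S g])
  moreover have "((\<lambda>x. f (g x)) has_real_derivative f' (g x) * g' x) (at x)" if "x \<in> S" for x
    using that f'(1) g'(1) Suc.prems(3) by (intro DERIV_chain2) auto
  ultimately show ?case
    unfolding times_differentiable.simps by (intro exI[of _ "\<lambda>x. f' (g x) * g' x"]) simp
qed simp

text \<open>The derivative is a polynomial in \<open>inverse\<close> itself, so the induction
  closes. For \<open>sqrt\<close> below it is half of \<open>inverse\<close> composed with
  \<open>sqrt\<close>, one level lower.\<close>

lemma times_differentiable_inverse: "times_differentiable n {0<..} inverse"
proof (induction n)
  case (Suc n)
  have "times_differentiable n {0<..} (\<lambda>x. (- 1) * (inverse x * inverse x))"
    by (intro times_differentiable_mult times_differentiable_const Suc.IH)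
  then show ?case unfolding times_differentiable.simps
    by (intro exI[of _ "\<lambda>x. (- 1) * (inverse x * inverse x)"])
      (auto intro!: derivative_eq_intros)
qed simp

lemma times_differentiable_sqrt: "times_differentiable n {0<..} sqrt"
proof (induction n)
  case (Suc n)
  have "times_differentiable n {0<..} (\<lambda>x. inverse (sqrt x) * (1/2))"
    using Suc.IH
    by (intro times_differentiable_mult times_differentiable_const
        times_differentiable_compose[OF times_differentiable_inverse]) auto
  then show ?case unfolding times_differentiable.simps
    by (intro exI[of _ "\<lambda>x. inverse (sqrt x) * (1/2)"])
      (auto intro!: derivative_eq_intros simp: field_simps)
qed simp

lemma smooth_on_subset: "smooth_on S f \<Longrightarrow> T \<subseteq> S \<Longrightarrow> smooth_on T f"
  unfolding smooth_on_def using times_differentiable_subset by blast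

lemma smooth_on_const: "smooth_on S (\<lambda>x. c)"
  and smooth_on_id: "smooth_on S (\<lambda>x. x)"
  by (simp_all add: smooth_on_def times_differentiable_const times_differentiable_id)

lemma smooth_on_add:
    "smooth_on S f \<Longrightarrow> smooth_on S g \<Longrightarrow> smooth_on S (\<lambda>x. f x + g x)"
  and smooth_on_mult:
    "smooth_on S f \<Longrightarrow> smooth_on S g \<Longrightarrow> smooth_on S (\<lambda>x. f x * g x)"
  by (simp_all add: smooth_on_def times_differentiable_add times_differentiable_mult)

lemma smooth_on_compose:
  "smooth_on T f \<Longrightarrow> smooth_on S g \<Longrightarrow> g ` S \<subseteq> T \<Longrightarrow> smooth_on S (\<lambda>x. f (g x))"
  unfolding smooth_on_def by (intro allI times_differentiable_compose[of _ T f S g]) auto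

lemma smooth_on_minus: "smooth_on S f \<Longrightarrow> smooth_on S (\<lambda>x. - f x)"
  using smooth_on_mult[OF smooth_on_const[of S "- 1"], of f] by (simp only: mult_minus1)

lemma smooth_on_diff:
  "smooth_on S f \<Longrightarrow> smooth_on S g \<Longrightarrow> smooth_on S (\<lambda>x. f x - g x)"
  using smooth_on_add[OF _ smooth_on_minus, of S f g] by (simp only: add_uminus_conv_diff)

lemma smooth_on_power:
  "smooth_on S f \<Longrightarrow> smooth_on S (\<lambda>x. f x ^ k)"
proof (induction k)
  case 0
  show ?case unfolding power_0 by (rule smooth_on_const)
next
  case (Suc k)
  then show ?case unfolding power_Suc by (intro smooth_on_mult)
qed

lemma smooth_on_divide:
  assumes "smooth_on S f" "smooth_on S g" "\<And>x. x \<in> S \<Longrightarrow> g x > 0"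
  shows "smooth_on S (\<lambda>x. f x / g x)"
proof -
  have "smooth_on {0<..} inverse"
    by (simp add: smooth_on_def times_differentiable_inverse)
  then have "smooth_on S (\<lambda>x. inverse (g x))"
    using assms by (intro smooth_on_compose[of "{0<..}" inverse S g]) auto
  with assms(1) show ?thesis
    unfolding divide_inverse by (rule smooth_on_mult)
qed

lemma smooth_on_sqrt:
  assumes "smooth_on S g" "\<And>x. x \<in> S \<Longrightarrow> g x > 0"
  shows "smooth_on S (\<lambda>x. sqrt (g x))"
proof -
  have "smooth_on {0<..} sqrt"
    by (simp add: smooth_on_def times_differentiable_sqrt)
  then show ?thesis
    using assms by (intro smooth_on_compose[of "{0<..}" sqrt S g]) auto
qed

lemma smooth_on_has_deriv:
  assumes "smooth_on S f" "x \<in> S"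
  shows "(f has_real_derivative deriv f x) (at x)"
proof -
  have "times_differentiable (Suc 0) S f"
    using assms(1) unfolding smooth_on_def by blast
  then show ?thesis
    using assms(2) by (auto simp: DERIV_imp_deriv)
qed

lemma smooth_on_deriv:
  assumes "open S" "smooth_on S f"
  shows "smooth_on S (deriv f)"
  unfolding smooth_on_def
proof
  fix n
  have "times_differentiable (Suc n) S f"
    using assms(2) unfolding smooth_on_def by blast
  then obtain f' where
    f': "\<And>x. x \<in> S \<Longrightarrow> (f has_real_derivative f' x) (at x)" "times_differentiable n S f'"
    unfolding times_differentiable.simps by blast
  show "times_differentiable n S (deriv f)"
    using f'(1)[THEN DERIV_imp_deriv] f'(2)
    by (intro times_differentiable_cong[OF assms(1), of f' "deriv f" n]) simp_all
qed

lemma smooth_on_imp_continuous_on: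
  assumes "smooth_on S f"
  shows "continuous_on S f"
  using DERIV_isCont[OF smooth_on_has_deriv[OF assms]]
  by (rule continuous_at_imp_continuous_on[OF ballI])

lemma smooth_on_pos_imp_smooth_on:
  assumes "smooth_on_pos f"
  shows "smooth_on {0<..} f"
proof -
  have "times_differentiable n {0<..} ((deriv ^^ k) f)" for n k
  proof (induction n arbitrary: k)
    case (Suc n)
    have "((deriv ^^ k) f has_real_derivative (deriv ^^ Suc k) f x) (at x)" if "x > 0" for x
    proof -
      have "(deriv ^^ k) f differentiable_on {0<..}"
        using assms unfolding smooth_on_pos_def by blast
      then have "(deriv ^^ k) f differentiable (at x)"
        using that by (simp add: differentiable_on_eq_differentiable_at)
      then show ?thesis
        by (simp add: DERIV_deriv_iff_real_differentiable)
    qed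
    then show ?case
      unfolding times_differentiable.simps
      by (intro exI[of _ "(deriv ^^ Suc k) f"] conjI ballI Suc.IH) (simp del: funpow.simps)
  qed simp
  from this[of _ 0] show ?thesis by (simp add: smooth_on_def)
qed

text \<open>Bootstrapping: if \<open>u\<close> has \<open>n\<close> derivatives, so has
  \<open>q (u x)\<close>, which is the derivative of \<open>u\<close>.\<close>

lemma smooth_on_autonomous_ode:
  assumes "smooth_on J q" "\<And>x. u x \<in> J" "\<And>x. (u has_real_derivative q (u x)) (at x)"
  shows "smooth_on UNIV u"
proof -
  have "times_differentiable n UNIV u" for n
  proof (induction n)
    case (Suc n)
    then have "times_differentiable n UNIV (\<lambda>x. q (u x))"
      using assms(1,2) by (intro times_differentiable_compose[of n J q UNIV u]) (auto simp: smooth_on_def)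
    then show ?case
      unfolding times_differentiable.simps using assms(3) by (intro exI[of _ "\<lambda>x. q (u x)"]) simp
  qed simp
  then show ?thesis by (simp add: smooth_on_def)
qed

subsection \<open>Plane fields\<close>

text \<open>No regularity of \<open>g\<close> is assumed: a shift of the argument preserves the set
  of possible derivatives, hence also the value that \<open>deriv\<close> chooses from it.\<close>

lemma partial_plane:
  "partial \<beta> (\<lambda>x. g (x $ 1)) = (\<lambda>x. if \<beta> = 1 then deriv g (x $ 1) else 0)"
proof
  fix x :: spacetime
  have "deriv (\<lambda>t. g (x $ 1 + t)) 0 = deriv g (x $ 1)"
    unfolding deriv_def using DERIV_shift[of g _ 0 "x $ 1"] by (simp add: add.commute)
  then show "partial \<beta> (\<lambda>x. g (x $ 1)) x = (if \<beta> = 1 then deriv g (x $ 1) else 0)"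
    by (simp add: partial_def axis_def)
qed

lemma smooth_field_plane:
  assumes "smooth_on UNIV g"
  shows "smooth_field (\<lambda>x. g (x $ 1))"
  unfolding smooth_field_def
proof (intro allI)
  fix \<beta>s :: "4 list" and x :: spacetime
  \<comment> \<open>Iterated partial derivatives remain plane fields with smooth profiles; an index
    other than 1 gives the zero profile.\<close>
  have "\<exists>h. smooth_on UNIV h \<and> foldr partial \<beta>s (\<lambda>x. g (x $ 1)) = (\<lambda>x. h (x $ 1))"
  proof (induction \<beta>s)
    case Nil
    with assms show ?case by auto
  next
    case (Cons \<beta> \<beta>s)
    then obtain h where h: "smooth_on UNIV h"
      "foldr partial \<beta>s (\<lambda>x. g (x $ 1)) = (\<lambda>x. h (x $ 1))" by auto
    then have "smooth_on UNIV (\<lambda>x. if \<beta> = 1 then deriv h x else 0)"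
      by (cases "\<beta> = 1") (simp_all add: smooth_on_deriv smooth_on_const)
    with h(2) show ?case by (auto simp: partial_plane)
  qed
  then obtain h where h: "smooth_on UNIV h"
    "foldr partial \<beta>s (\<lambda>x. g (x $ 1)) = (\<lambda>x. h (x $ 1))" by auto
  have "h differentiable at (x $ 1)"
    using smooth_on_has_deriv[OF h(1)] real_differentiable_def by blast
  then have "(h \<circ> (\<lambda>x. x $ 1)) differentiable at x"
    by (rule differentiable_chain_at[OF bounded_linear_imp_differentiable[OF bounded_linear_vec_nth]])
  then show "foldr partial \<beta>s (\<lambda>x. g (x $ 1)) differentiable at x"
    by (simp add: h(2) o_def)
qed

text \<open>\<open>sum_4\<close> and \<open>exhaust_4\<close> enumerate the indices as 1, 2, 3, 4,
  so the time component appears as the last one.\<close>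

lemma four_eq_zero: "(4::4) = 0" by simp

lemma mink_prod_expand:
  "mink_prod v w = - (v $ 0 * w $ 0) + v $ 1 * w $ 1 + v $ 2 * w $ 2 + v $ 3 * w $ 3"
  by (simp add: mink_prod_def minkowski_def sum_4 four_eq_zero)

lemma minkowski_vec_expand: "(minkowski *v v) $ \<alpha> = (if \<alpha> = 0 then - 1 else 1) * v $ \<alpha>"
  using exhaust_4[of \<alpha>]
  by (auto simp: matrix_vector_mult_def minkowski_def sum_4 four_eq_zero)

lemma grad_plane: "grad (\<lambda>x. g (x $ 1)) x = axis 1 (deriv g (x $ 1))"
  by (simp add: grad_def partial_plane axis_def vec_eq_iff)

lemma mink_prod_axis1: "mink_prod (axis 1 d) (axis 1 d) = d\<^sup>2"
  by (simp add: mink_prod_expand axis_def power2_eq_square)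

lemma partial_ext_energy:
  "partial \<gamma> (ext_energy r \<kappa> n) p = \<kappa> n * (minkowski *v p) $ \<gamma>"
proof -
  have "((\<lambda>t. r n + 1/2 * \<kappa> n * (mink_prod (p + t *\<^sub>R axis \<gamma> 1) (p + t *\<^sub>R axis \<gamma> 1)))
      has_real_derivative \<kappa> n * (minkowski *v p) $ \<gamma>) (at 0)"
    unfolding mink_prod_expand minkowski_vec_expand using exhaust_4[of \<gamma>]
    by (auto intro!: derivative_eq_intros simp: axis_def)
  then show ?thesis
    unfolding partial_def ext_energy_def by (rule DERIV_imp_deriv)
qed

subsection \<open>Stationary profiles\<close>

text \<open>For \<open>n > 0\<close> this is the state of density \<open>n\<close> with particle
  flux \<nu> U^1 = m; U^0 comes from the normalisation of the velocity.\<close>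

definition moving_state :: "real \<Rightarrow> real \<Rightarrow> state"
  where "moving_state m n = (n, sqrt (1 + (m / n)\<^sup>2), m / n)"

lemma density_moving_state [simp]: "density (moving_state m n) = n"
  by (simp add: moving_state_def)

lemma velocity_moving_state:
  "velocity (moving_state m n) =
    (\<chi> \<alpha>. if \<alpha> = 0 then sqrt (1 + (m / n)\<^sup>2) else if \<alpha> = 1 then m / n else 0)"
  by (simp add: moving_state_def)

lemma mink_prod_velocity_moving_state:
  "mink_prod (velocity (moving_state m n)) (velocity (moving_state m n)) = - 1"
proof -
  have "sqrt (1 + (m / n)\<^sup>2) * sqrt (1 + (m / n)\<^sup>2) = 1 + (m / n)\<^sup>2"
    by simp
  then show ?thesis
    by (simp add: mink_prod_expand velocity_moving_state power2_eq_square)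
qed

lemma sqrt_one_plus_quotient:
  assumes "n > 0"
  shows "sqrt (1 + (m / n)\<^sup>2) = sqrt (n\<^sup>2 + m\<^sup>2) / n"
proof -
  have "1 + (m / n)\<^sup>2 = (n\<^sup>2 + m\<^sup>2) / n\<^sup>2"
    using assms by (simp add: field_simps)
  then show ?thesis
    using assms by (simp add: real_sqrt_divide)
qed

lemma deriv_ext_energy:
  assumes "(r has_real_derivative r') (at n)" "(\<kappa> has_real_derivative \<kappa>') (at n)"
  shows "deriv (\<lambda>n. ext_energy r \<kappa> n p) n = r' + 1/2 * \<kappa>' * mink_prod p p"
  unfolding ext_energy_def
  using assms by (intro DERIV_imp_deriv) (auto intro!: derivative_eq_intros)

text \<open>The first integral \<open>\<kappa> u'\<^sup>2 / 2 = W(u)\<close> with \<open>W(n) = r(n) - a sqrt(n\<^sup>2 + m\<^sup>2) + c\<close> makes the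
  energy flux \<open>T\<^sup>0\<^sup>1 = a m\<close> and the momentum flux \<open>T\<^sup>1\<^sup>1 = c\<close> constant.\<close>

locale stationary_profile =
  fixes r \<kappa> u :: "real \<Rightarrow> real" and a c m :: real
  assumes smooth_r: "smooth_on {0<..} r"
    and smooth_\<kappa>: "smooth_on {0<..} \<kappa>"
    and smooth_u: "smooth_on UNIV u"
    and u_pos: "\<And>x. u x > 0"
    and u_deriv_nonzero: "\<And>x. deriv u x \<noteq> 0"
    and first_integral:
      "\<And>x. 1/2 * \<kappa> (u x) * (deriv u x)\<^sup>2 = r (u x) - a * sqrt ((u x)\<^sup>2 + m\<^sup>2) + c"
begin

lemma u_deriv: "(u has_real_derivative deriv u x) (at x)"
  using smooth_on_has_deriv[OF smooth_u] by simp

lemma u_deriv2: "(deriv u has_real_derivative deriv (deriv u) x) (at x)"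
  using smooth_on_has_deriv[OF smooth_on_deriv[OF _ smooth_u]] by simp

lemma r_deriv: "(r has_real_derivative deriv r (u x)) (at (u x))"
  using smooth_on_has_deriv[OF smooth_r] u_pos by simp

lemma \<kappa>_deriv: "(\<kappa> has_real_derivative deriv \<kappa> (u x)) (at (u x))"
  using smooth_on_has_deriv[OF smooth_\<kappa>] u_pos by simp

lemma r_u_deriv: "((\<lambda>x. r (u x)) has_real_derivative deriv r (u x) * deriv u x) (at x)"
  by (rule DERIV_chain2[where f = r and g = u, OF r_deriv u_deriv])

lemma \<kappa>_u_deriv: "((\<lambda>x. \<kappa> (u x)) has_real_derivative deriv \<kappa> (u x) * deriv u x) (at x)"
  by (rule DERIV_chain2[where f = \<kappa> and g = u, OF \<kappa>_deriv u_deriv])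

lemma radicand_pos: "(u x)\<^sup>2 + m\<^sup>2 > 0"
  using u_pos[of x] by (simp add: add_pos_nonneg)

text \<open>Differentiating the first integral gives this identity multiplied by
  \<open>deriv u x\<close>; the factor cancels because the profile has no critical point.\<close>

lemma second_order:
  "\<kappa> (u x) * deriv (deriv u) x + 1/2 * deriv \<kappa> (u x) * (deriv u x)\<^sup>2
    = deriv r (u x) - a * u x / sqrt ((u x)\<^sup>2 + m\<^sup>2)"
proof -
  have "((\<lambda>x. 1/2 * \<kappa> (u x) * (deriv u x)\<^sup>2) has_real_derivative
      1/2 * (deriv \<kappa> (u x) * deriv u x) * (deriv u x)\<^sup>2
        + \<kappa> (u x) * deriv u x * deriv (deriv u) x) (at x)"
    by (rule \<kappa>_u_deriv u_deriv2 u_deriv derivative_eq_intros refl)+ simp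
  moreover have "((\<lambda>x. sqrt ((u x)\<^sup>2 + m\<^sup>2)) has_real_derivative
      u x * deriv u x / sqrt ((u x)\<^sup>2 + m\<^sup>2)) (at x)"
    using radicand_pos[of x] by (auto intro!: derivative_eq_intros u_deriv simp: field_simps)
  then have "((\<lambda>x. r (u x) - a * sqrt ((u x)\<^sup>2 + m\<^sup>2) + c) has_real_derivative
      deriv r (u x) * deriv u x - a * (u x * deriv u x / sqrt ((u x)\<^sup>2 + m\<^sup>2))) (at x)"
    using DERIV_add[OF DERIV_diff[OF r_u_deriv DERIV_cmult] DERIV_const] by fastforce
  ultimately have "1/2 * (deriv \<kappa> (u x) * deriv u x) * (deriv u x)\<^sup>2
        + \<kappa> (u x) * deriv u x * deriv (deriv u) x
      = deriv r (u x) * deriv u x - a * (u x * deriv u x / sqrt ((u x)\<^sup>2 + m\<^sup>2))"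
    unfolding first_integral by (rule DERIV_unique)
  then have "deriv u x * (\<kappa> (u x) * deriv (deriv u) x + 1/2 * deriv \<kappa> (u x) * (deriv u x)\<^sup>2)
      = deriv u x * (deriv r (u x) - a * u x / sqrt ((u x)\<^sup>2 + m\<^sup>2))"
    by (simp add: algebra_simps)
  then show ?thesis
    using u_deriv_nonzero[of x] by (simp only: mult_cancel_left) simp
qed

abbreviation (input) plane_density :: "spacetime \<Rightarrow> real"
  where "plane_density x \<equiv> u (x $ 1)"

abbreviation (input) plane_velocity :: "spacetime \<Rightarrow> real^4"
  where "plane_velocity x \<equiv> velocity (moving_state m (u (x $ 1)))"

text \<open>The capillary terms are those of \<open>second_order\<close>, so all derivatives of
  \<open>u\<close> drop out. As U^0 = sqrt(u^2 + m^2) / u, the result is Bernoulli's law: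
  variational derivative times U^0 equals \<open>a\<close>.\<close>

lemma variational_derivative_profile:
  "variational_derivative (ext_energy r \<kappa>) plane_density x
    = a * u (x $ 1) / sqrt ((u (x $ 1))\<^sup>2 + m\<^sup>2)"
proof -
  have "partial \<gamma> (\<lambda>y. partial \<gamma> (ext_energy r \<kappa> (plane_density y)) (grad plane_density y)) x
      = (if \<gamma> = 1 then deriv (\<lambda>s. \<kappa> (u s) * deriv u s) (x $ 1) else 0)" for \<gamma>
  proof -
    have "partial \<gamma> (ext_energy r \<kappa> (plane_density y)) (grad plane_density y)
        = (if \<gamma> = 1 then \<kappa> (u (y $ 1)) * deriv u (y $ 1) else 0)" for y
      by (simp add: partial_ext_energy grad_plane minkowski_vec_expand axis_def)
    then show ?thesis
      using partial_plane[of \<gamma> "\<lambda>s. if \<gamma> = 1 then \<kappa> (u s) * deriv u s else 0"]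
      by simp
  qed
  moreover have "deriv (\<lambda>s. \<kappa> (u s) * deriv u s) (x $ 1)
      = deriv \<kappa> (u (x $ 1)) * (deriv u (x $ 1))\<^sup>2 + \<kappa> (u (x $ 1)) * deriv (deriv u) (x $ 1)"
    by (rule DERIV_imp_deriv)
      (rule \<kappa>_u_deriv u_deriv2 u_deriv derivative_eq_intros refl |
        simp add: power2_eq_square)+
  ultimately have "variational_derivative (ext_energy r \<kappa>) plane_density x
      = deriv r (u (x $ 1)) + 1/2 * deriv \<kappa> (u (x $ 1)) * (deriv u (x $ 1))\<^sup>2
        - (deriv \<kappa> (u (x $ 1)) * (deriv u (x $ 1))\<^sup>2 + \<kappa> (u (x $ 1)) * deriv (deriv u) (x $ 1))"
    by (simp add: variational_derivative_def grad_plane mink_prod_axis1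
        deriv_ext_energy[OF r_deriv \<kappa>_deriv])
  then show ?thesis
    using second_order[of "x $ 1"] by (simp add: algebra_simps)
qed

lemma ext_pressure_profile:
  "ext_pressure r \<kappa> plane_density x
    = a * (u (x $ 1))\<^sup>2 / sqrt ((u (x $ 1))\<^sup>2 + m\<^sup>2)
      - (r (u (x $ 1)) + 1/2 * \<kappa> (u (x $ 1)) * (deriv u (x $ 1))\<^sup>2)"
  unfolding ext_pressure_def variational_derivative_profile
  by (simp add: ext_energy_def grad_plane mink_prod_axis1 power2_eq_square)

text \<open>Only the column \<beta> = 1 can contribute to the divergence of a plane field. In the
  energy flux the extended energy \<open>e\<close> cancels. The momentum flux is
  \<open>a * f - e\<close> plus the capillary stress, which the first integral reduces to
  \<open>c\<close>.\<close>

lemma korteweg_tensor_profile: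
  "korteweg_tensor r \<kappa> plane_density plane_velocity \<alpha> 1 x
    = (if \<alpha> = 0 then a * m else if \<alpha> = 1 then c else 0)"
proof -
  let ?u = "u (x $ 1)"
  define f where "f = sqrt (?u\<^sup>2 + m\<^sup>2)"
  define e where "e = r ?u + 1/2 * \<kappa> ?u * (deriv u (x $ 1))\<^sup>2"
  have f_pos: "f > 0" and f_sq: "f\<^sup>2 = ?u\<^sup>2 + m\<^sup>2"
    using radicand_pos[of "x $ 1"] by (simp_all add: f_def)
  have p: "ext_pressure r \<kappa> plane_density x = a * ?u\<^sup>2 / f - e"
    unfolding ext_pressure_profile f_def e_def ..
  have e: "ext_energy r \<kappa> (plane_density x) (grad plane_density x) = e"
    by (simp add: ext_energy_def grad_plane mink_prod_axis1 e_def)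
  have u0: "sqrt (1 + (m / ?u)\<^sup>2) = f / ?u"
    using sqrt_one_plus_quotient[OF u_pos] by (simp add: f_def)
  have tensor: "korteweg_tensor r \<kappa> plane_density plane_velocity \<alpha> 1 x
    = (if \<alpha> = 0 then e * (f / ?u) * (m / ?u) + (a * ?u\<^sup>2 / f - e) * ((f / ?u) * (m / ?u))
       else if \<alpha> = 1 then e * (m / ?u) * (m / ?u) + (a * ?u\<^sup>2 / f - e) * (1 + (m / ?u) * (m / ?u))
         + \<kappa> ?u * (deriv u (x $ 1))\<^sup>2
       else 0)"
    unfolding korteweg_tensor_def p e
    unfolding projector_def velocity_moving_state u0 minkowski_vec_expand grad_plane
    by (simp add: minkowski_def axis_def power2_eq_square)
  have "e * (f / ?u) * (m / ?u) + (a * ?u\<^sup>2 / f - e) * ((f / ?u) * (m / ?u)) = a * m"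
    using f_pos u_pos[of "x $ 1"] by (simp add: field_simps power2_eq_square)
  moreover have "e * (m / ?u) * (m / ?u) + (a * ?u\<^sup>2 / f - e) * (1 + (m / ?u) * (m / ?u))
         + \<kappa> ?u * (deriv u (x $ 1))\<^sup>2 = c"
  proof -
    have "1 + (m / ?u) * (m / ?u) = f\<^sup>2 / ?u\<^sup>2"
      using u_pos[of "x $ 1"] unfolding f_sq by (simp add: field_simps power2_eq_square)
    then have flux: "a * ?u\<^sup>2 / f * (1 + (m / ?u) * (m / ?u)) = a * f"
      using u_pos[of "x $ 1"] f_pos by (simp add: power2_eq_square)
    have regroup: "e * k * k + (p - e) * (1 + k * k) = p * (1 + k * k) - e" for k p
      by (simp add: algebra_simps)
    show ?thesis
      using first_integral[of "x $ 1"] unfolding regroup flux unfolding f_def[symmetric] e_def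
      by (simp add: field_simps)
  qed
  ultimately show ?thesis unfolding tensor by simp
qed

text \<open>The point with all coordinates \<open>x $ 1\<close> represents the plane through
  \<open>x\<close>. This exhibits every component as a plane field, so that
  \<open>partial_plane\<close> kills the derivatives in the other directions.\<close>

lemma korteweg_tensor_plane:
  "korteweg_tensor r \<kappa> plane_density plane_velocity \<alpha> \<beta> x
    = korteweg_tensor r \<kappa> plane_density plane_velocity \<alpha> \<beta> (\<chi> i. x $ 1)"
  unfolding korteweg_tensor_def ext_pressure_profile by (simp add: grad_plane)

lemma euler_korteweg_solution_profile:
  "euler_korteweg_solution r \<kappa> plane_density plane_velocity"
  unfolding euler_korteweg_solution_def
proof (intro conjI allI)
  show "smooth_field plane_density"
    by (intro smooth_field_plane smooth_u)
next
  fix \<alpha> :: 4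
  have quot: "smooth_on UNIV (\<lambda>s. m / u s)"
    by (intro smooth_on_divide smooth_on_const smooth_u u_pos)
  then have "smooth_on UNIV (\<lambda>s. sqrt (1 + (m / u s)\<^sup>2))"
    by (intro smooth_on_sqrt smooth_on_add smooth_on_const smooth_on_power)
      (simp_all add: add_pos_nonneg)
  with quot have "smooth_on UNIV (\<lambda>s. velocity (moving_state m (u s)) $ \<alpha>)"
    unfolding velocity_moving_state
    by (cases "\<alpha> = 0"; cases "\<alpha> = 1") (simp_all add: smooth_on_const)
  then show "smooth_field (\<lambda>x. plane_velocity x $ \<alpha>)"
    by (rule smooth_field_plane)
next
  fix x :: spacetime
  show "plane_density x > 0" "mink_prod (plane_velocity x) (plane_velocity x) = - 1"
    by (rule u_pos mink_prod_velocity_moving_state)+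
  show "plane_velocity x $ 0 > 0"
    by (simp add: velocity_moving_state add_pos_nonneg)
next
  fix x :: spacetime and \<alpha> :: 4
  have "partial \<beta> (korteweg_tensor r \<kappa> plane_density plane_velocity \<alpha> \<beta>) x = 0" for \<beta>
  proof (cases "\<beta> = 1")
    case True
    have "korteweg_tensor r \<kappa> plane_density plane_velocity \<alpha> 1
        = (\<lambda>x. if \<alpha> = 0 then a * m else if \<alpha> = 1 then c else 0)"
      by (rule ext) (rule korteweg_tensor_profile)
    with True show ?thesis by (simp add: partial_def)
  next
    case False
    let ?g = "\<lambda>s. korteweg_tensor r \<kappa> plane_density plane_velocity \<alpha> \<beta> (\<chi> i. s)"
    have "korteweg_tensor r \<kappa> plane_density plane_velocity \<alpha> \<beta> = (\<lambda>x. ?g (x $ 1))"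
      by (rule ext) (rule korteweg_tensor_plane)
    then have "partial \<beta> (korteweg_tensor r \<kappa> plane_density plane_velocity \<alpha> \<beta>) x
        = partial \<beta> (\<lambda>x. ?g (x $ 1)) x"
      by (rule arg_cong[where f = "\<lambda>T. partial \<beta> T x"])
    also have "\<dots> = 0"
      unfolding partial_plane[of \<beta> ?g] using False by simp
    finally show ?thesis .
  qed
  then show "(\<Sum>\<beta>\<in>UNIV. partial \<beta> (korteweg_tensor r \<kappa> plane_density plane_velocity \<alpha> \<beta>) x) = 0"
    by simp
qed

end

subsection \<open>Heteroclinic orbits of scalar equations\<close>

text \<open>The linear bounds make \<open>1 / q\<close> non-integrable at both ends: the orbit needs
  infinite time to approach \<open>l\<close> and \<open>h\<close>, and is defined for all times.
  Nothing is asked of \<open>q\<close> at the end points themselves.\<close>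

lemma heteroclinic_orbit:
  fixes q :: "real \<Rightarrow> real"
  assumes lh: "l < h" and C: "C > 0"
    and cont: "\<And>x. l < x \<Longrightarrow> x < h \<Longrightarrow> isCont q x"
    and pos: "\<And>x. l < x \<Longrightarrow> x < h \<Longrightarrow> q x > 0"
    and lower: "\<And>x. l < x \<Longrightarrow> x < h \<Longrightarrow> q x \<le> C * (x - l)"
    and upper: "\<And>x. l < x \<Longrightarrow> x < h \<Longrightarrow> q x \<le> C * (h - x)"
  obtains u where "\<And>x. l < u x" "\<And>x. u x < h"
    "\<And>x. (u has_real_derivative q (u x)) (at x)"
    "(u \<longlongrightarrow> l) at_bot" "(u \<longlongrightarrow> h) at_top"
proof -
  \<comment> \<open>The orbit is the inverse of the time map \<open>F\<close>, an antiderivative of \<open>1 / q\<close>.\<close>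
  have "\<exists>F. \<forall>x. ereal l < ereal x \<longrightarrow> ereal x < ereal h \<longrightarrow>
      (F has_vector_derivative inverse (q x)) (at x)"
    using lh cont pos
    by (intro einterval_antiderivative continuous_at_within_inverse) (auto simp: less_imp_neq[symmetric])
  then obtain F where F: "(F has_real_derivative inverse (q x)) (at x)" if "l < x" "x < h" for x
    by (auto simp: has_real_derivative_iff_has_vector_derivative)
  have F_mono: "F x < F y" if "l < x" "x < y" "y < h" for x y
  proof (rule DERIV_pos_imp_increasing[OF \<open>x < y\<close>])
    fix z assume "x \<le> z" "z \<le> y"
    with that show "\<exists>d. (F has_real_derivative d) (at z) \<and> 0 < d"
      using F[of z] pos[of z] by force
  qed
  define x0 where "x0 = (l + h) / 2"
  have x0: "l < x0" "x0 < h" using lh by (auto simp: x0_def)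
  \<comment> \<open>\<open>1 / q\<close> dominates \<open>1 / (C * (x - l))\<close>, so subtracting
    the logarithm leaves a nondecreasing function.\<close>
  have below: "F x \<le> F x0 + (ln (x - l) - ln (x0 - l)) / C" if "l < x" "x \<le> x0" for x
  proof -
    have "F x - ln (x - l) / C \<le> F x0 - ln (x0 - l) / C"
    proof (rule DERIV_nonneg_imp_nondecreasing[OF \<open>x \<le> x0\<close>])
      fix z assume z: "x \<le> z" "z \<le> x0"
      with that x0 have z': "l < z" "z < h" by auto
      have "((\<lambda>x. F x - ln (x - l) / C) has_real_derivative inverse (q z) - 1 / (z - l) / C) (at z)"
        using z' C by (auto intro!: derivative_eq_intros F)
      moreover have "1 / (z - l) / C \<le> inverse (q z)"
        using lower[OF z'] pos[OF z'] C z'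
        by (simp add: field_simps)
      ultimately show "\<exists>d. ((\<lambda>x. F x - ln (x - l) / C) has_real_derivative d) (at z) \<and> 0 \<le> d"
        by force
    qed
    then show ?thesis by (simp add: diff_divide_distrib)
  qed
  have above: "F x0 + (ln (h - x0) - ln (h - x)) / C \<le> F x" if "x0 \<le> x" "x < h" for x
  proof -
    have "F x0 + ln (h - x0) / C \<le> F x + ln (h - x) / C"
    proof (rule DERIV_nonneg_imp_nondecreasing[OF \<open>x0 \<le> x\<close>])
      fix z assume z: "x0 \<le> z" "z \<le> x"
      with that x0 have z': "l < z" "z < h" by auto
      have "((\<lambda>x. F x + ln (h - x) / C) has_real_derivative inverse (q z) - 1 / (h - z) / C) (at z)"
        using z' C by (auto intro!: derivative_eq_intros F)
      moreover have "1 / (h - z) / C \<le> inverse (q z)"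
        using upper[OF z'] pos[OF z'] C z'
        by (simp add: field_simps)
      ultimately show "\<exists>d. ((\<lambda>x. F x + ln (h - x) / C) has_real_derivative d) (at z) \<and> 0 \<le> d"
        by force
    qed
    then show ?thesis by (simp add: diff_divide_distrib)
  qed
  have F_cont: "isCont F x" if "l < x" "x < h" for x
    using F[OF that] by (rule DERIV_isCont)
  have F_low: "\<exists>x>l. x < h \<and> F x \<le> t" for t
  proof -
    \<comment> \<open>\<open>s\<close> solves \<open>F x0 + (s - ln (x0 - l)) / C = t\<close>, so
      \<open>below\<close> bounds \<open>F\<close> by \<open>t\<close> at \<open>l + exp s\<close>;
      the minimum with \<open>x0\<close> keeps \<open>x\<close> in the range of that bound.\<close>
    define s where "s = C * (t - F x0) + ln (x0 - l)"
    define x where "x = min x0 (l + exp s)"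
    have x: "l < x" "x \<le> x0" using x0 by (auto simp: x_def)
    have "ln (x - l) \<le> ln (exp s)"
      using x by (subst ln_le_cancel_iff) (auto simp: x_def)
    then have "(ln (x - l) - ln (x0 - l)) / C \<le> t - F x0"
      using C by (simp add: s_def divide_le_eq mult.commute)
    with below[OF x] x x0 show ?thesis by (intro exI[of _ x]) auto
  qed
  have F_high: "\<exists>x>l. x < h \<and> t \<le> F x" for t
  proof -
    define s where "s = ln (h - x0) - C * (t - F x0)"
    define x where "x = max x0 (h - exp s)"
    have x: "x0 \<le> x" "x < h" using x0 by (auto simp: x_def)
    have "ln (h - x) \<le> ln (exp s)"
      using x by (subst ln_le_cancel_iff) (auto simp: x_def)
    then have "t - F x0 \<le> (ln (h - x0) - ln (h - x)) / C"
      using C by (simp add: s_def le_divide_eq mult.commute)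
    with above[OF x] x x0 show ?thesis by (intro exI[of _ x]) auto
  qed
  have surj: "\<exists>x. l < x \<and> x < h \<and> F x = t" for t
  proof -
    obtain x y where x: "l < x" "x < h" "F x \<le> t" and y: "l < y" "y < h" "t \<le> F y"
      using F_low F_high by meson
    have "x \<le> y"
    proof (rule ccontr)
      assume "\<not> x \<le> y"
      then have "F y < F x" using F_mono x y by auto
      with x y have "F x = t" "F y = t" by auto
      with \<open>F y < F x\<close> show False by simp
    qed
    then have "\<exists>z\<ge>x. z \<le> y \<and> F z = t"
      using x y F_cont by (intro IVT) auto
    with x y show ?thesis by (metis le_less_trans less_le_trans)
  qed
  define u where "u t = (SOME x. l < x \<and> x < h \<and> F x = t)" for t
  have u: "l < u t" "u t < h" "F (u t) = t" for t
    using someI_ex[OF surj[of t]] by (simp_all add: u_def)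
  have uF: "u (F x) = x" if "l < x" "x < h" for x
    using F_mono[of x "u (F x)"] F_mono[of "u (F x)" x] u[of "F x"] that
    by (metis less_irrefl linorder_neqE_linordered_idom)
  have u_deriv: "(u has_real_derivative q (u x)) (at x)" for x
  proof -
    \<comment> \<open>Inverse function theorem for \<open>F\<close>, whose derivative at
      \<open>u x\<close> is \<open>inverse (q (u x))\<close>.\<close>
    have "(u has_real_derivative inverse (inverse (q (u x)))) (at x)"
      using u[of x] pos[of "u x"] F F_cont uF
      unfolding has_field_derivative_def
      by (intro has_derivative_inverse_strong_x[of "{l<..<h}" u x F "(*) (inverse (q (u x)))"])
        (auto intro!: continuous_at_imp_continuous_on)
    then show ?thesis by simp
  qed
  have u_mono: "s \<le> u t" if "l < s" "s < h" "F s \<le> t" for s t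
    using F_mono[of "u t" s] u[of t] that by force
  have u_mono': "u t \<le> s" if "l < s" "s < h" "t \<le> F s" for s t
    using F_mono[of s "u t"] u[of t] that by force
  have "(u \<longlongrightarrow> l) at_bot"
  proof (rule order_tendstoI)
    fix b assume "b < l"
    then show "\<forall>\<^sub>F t in at_bot. b < u t"
      using u(1) by (intro always_eventually allI) (meson less_trans)
  next
    fix b assume "l < b"
    define s where "s = (l + min b h) / 2"
    have s: "l < s" "s < h" "s < b" using \<open>l < b\<close> lh by (auto simp: s_def min_def)
    show "\<forall>\<^sub>F t in at_bot. u t < b"
      using eventually_le_at_bot[of "F s"] by eventually_elim (use u_mono' s in force)
  qed
  moreover have "(u \<longlongrightarrow> h) at_top"
  proof (rule order_tendstoI)
    fix b assume "h < b"
    then show "\<forall>\<^sub>F t in at_top. u t < b"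
      using u(2) by (intro always_eventually allI) (meson less_trans)
  next
    fix b assume "b < h"
    define s where "s = (h + max b l) / 2"
    have s: "l < s" "s < h" "b < s" using \<open>b < h\<close> lh by (auto simp: s_def max_def)
    show "\<forall>\<^sub>F t in at_top. b < u t"
      using eventually_ge_at_top[of "F s"] by eventually_elim (use u_mono s in force)
  qed
  ultimately show thesis
    using that u u_deriv by blast
qed

text \<open>The mean value inequality is applied twice. The constant \<open>M\<close> in place of
  Taylor's \<open>M / 2\<close> is harmless, as only the order of vanishing matters.\<close>

lemma quadratic_bound:
  fixes f f' f'' :: "real \<Rightarrow> real"
  assumes f: "\<And>x. x \<in> {l..h} \<Longrightarrow> (f has_real_derivative f' x) (at x)"
    and f': "\<And>x. x \<in> {l..h} \<Longrightarrow> (f' has_real_derivative f'' x) (at x)"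
    and M: "\<And>x. x \<in> {l..h} \<Longrightarrow> \<bar>f'' x\<bar> \<le> M"
    and p: "p \<in> {l..h}" "f p = 0" "f' p = 0" and x: "x \<in> {l..h}"
  shows "\<bar>f x\<bar> \<le> M * (x - p)\<^sup>2"
proof -
  let ?S = "closed_segment p x"
  have S: "?S \<subseteq> {l..h}"
    using p x by (auto simp: closed_segment_eq_real_ivl split: if_splits)
  have bound: "\<bar>f' z\<bar> \<le> M * \<bar>x - p\<bar>" if "z \<in> ?S" for z
  proof -
    have "norm (f' z - f' p) \<le> M * norm (z - p)"
      using S that f' M p(1)
      by (intro field_differentiable_bound[of "{l..h}" f' f''])
        (auto intro: has_field_derivative_at_within)
    also have "\<dots> \<le> M * \<bar>x - p\<bar>"
      using that M[OF p(1)]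
      by (intro mult_left_mono) (auto simp: closed_segment_eq_real_ivl split: if_splits)
    finally show ?thesis using p(3) by simp
  qed
  have "norm (f x - f p) \<le> M * \<bar>x - p\<bar> * norm (x - p)"
    using S f bound
    by (intro field_differentiable_bound[of ?S f f'] has_field_derivative_at_within[OF f] subsetD[OF S])
      auto
  then show ?thesis
    using p(2) by (simp add: power2_eq_square mult.assoc flip: abs_mult)
qed

text \<open>With constant \<open>k\<close> this gives the end states of a profile, with varying
  \<open>k\<close> the continuity of the family in \<open>m\<close>.\<close>

lemma tendsto_moving_state:
  assumes "(k \<longlongrightarrow> m) F" "(v \<longlongrightarrow> n) F" "n \<noteq> 0"
  shows "((\<lambda>s. moving_state (k s) (v s)) \<longlongrightarrow> moving_state m n) F"
  unfolding moving_state_def by (intro tendsto_intros assms)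

text \<open>The first integral prescribes the speed \<open>sqrt (2 * W n / \<kappa> n)\<close>. The
  double zeros bound \<open>W\<close> quadratically, hence the speed linearly, at both ends. The
  first integral does not see the sign of the speed, so reflecting the orbit reverses the
  connection.\<close>

lemma heteroclinic_of_double_well:
  fixes r \<kappa> :: "real \<Rightarrow> real" and a c m l h :: real
  defines "W \<equiv> \<lambda>n. r n - a * sqrt (n\<^sup>2 + m\<^sup>2) + c"
  assumes r: "smooth_on {0<..} r"
    and \<kappa>: "smooth_on {0<..} \<kappa>" "\<And>n. n > 0 \<Longrightarrow> \<kappa> n > 0"
    and l: "0 < l" and lh: "l < h"
    and Wl: "W l = 0" "deriv W l = 0" and Wh: "W h = 0" "deriv W h = 0"
    and W_pos: "\<And>n. l < n \<Longrightarrow> n < h \<Longrightarrow> W n > 0"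
  shows "\<exists>w. heteroclinic_solution r \<kappa> w (moving_state m l) (moving_state m h)"
    and "\<exists>w. heteroclinic_solution r \<kappa> w (moving_state m h) (moving_state m l)"
proof -
  have W_smooth: "smooth_on {0<..} W"
    unfolding W_def
    by (intro smooth_on_add smooth_on_diff smooth_on_mult smooth_on_const smooth_on_sqrt
        smooth_on_power smooth_on_id r) (simp add: add_pos_nonneg)
  have sub: "{l..h} \<subseteq> {0<..}" using l by auto
  have "continuous_on {l..h} (deriv (deriv W))"
    by (rule continuous_on_subset[OF smooth_on_imp_continuous_on sub])
      (intro smooth_on_deriv open_greaterThan W_smooth)
  then have "compact (deriv (deriv W) ` {l..h})"
    by (intro compact_continuous_image compact_Icc)
  then obtain M where M: "\<And>x. x \<in> {l..h} \<Longrightarrow> \<bar>deriv (deriv W) x\<bar> \<le> M"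
    using compact_imp_bounded bounded_iff by (metis image_eqI real_norm_def)
  obtain x0 where x0: "x0 \<in> {l..h}" "\<And>x. x \<in> {l..h} \<Longrightarrow> \<kappa> x0 \<le> \<kappa> x"
    using continuous_attains_inf[of "{l..h}" \<kappa>] lh
      continuous_on_subset[OF smooth_on_imp_continuous_on[OF \<kappa>(1)] sub] by auto
  define k where "k = \<kappa> x0"
  have k: "k > 0" "\<And>x. x \<in> {l..h} \<Longrightarrow> k \<le> \<kappa> x"
    using x0 \<kappa>(2) l by (auto simp: k_def)
  have M_nonneg: "M \<ge> 0" using M[of l] lh by auto
  have quad: "W x \<le> M * (x - p)\<^sup>2" if "x \<in> {l..h}" "p = l \<or> p = h" for x p
  proof -
    have "\<bar>W x\<bar> \<le> M * (x - p)\<^sup>2"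
    proof (rule quadratic_bound[where f' = "deriv W" and f'' = "deriv (deriv W)"])
      fix y assume "y \<in> {l..h}"
      then have y: "y \<in> {0<..}" using sub by auto
      show "(W has_real_derivative deriv W y) (at y)"
        by (rule smooth_on_has_deriv[OF W_smooth y])
      show "(deriv W has_real_derivative deriv (deriv W) y) (at y)"
        by (rule smooth_on_has_deriv[OF smooth_on_deriv[OF open_greaterThan W_smooth] y])
    qed (use M that Wl Wh lh in auto)
    then show ?thesis by simp
  qed
  define q where "q n = sqrt (2 * W n / \<kappa> n)" for n
  \<comment> \<open>The summand 1 yields \<open>C > 0\<close> from \<open>M \<ge> 0\<close>
    alone.\<close>
  define C where "C = sqrt (2 * M / k) + 1"
  have C: "C > 0" using M_nonneg k by (simp add: C_def add_nonneg_pos)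
  have q_le: "q x \<le> C * \<bar>x - p\<bar>" if x: "l < x" "x < h" and p: "p = l \<or> p = h" for x p
  proof -
    have "2 * W x / \<kappa> x \<le> 2 * (M * (x - p)\<^sup>2) / k"
      using quad[of x p] x p k(1) k(2)[of x] W_pos[OF x] M_nonneg
      by (intro frac_le mult_left_mono) auto
    also have "\<dots> = (2 * M / k) * (x - p)\<^sup>2" by simp
    finally have "q x \<le> sqrt (2 * M / k) * \<bar>x - p\<bar>"
      unfolding q_def by (metis real_sqrt_abs real_sqrt_le_iff real_sqrt_mult)
    also have "\<dots> \<le> C * \<bar>x - p\<bar>"
      by (intro mult_right_mono) (auto simp: C_def)
    finally show ?thesis .
  qed
  have q_smooth: "smooth_on {l<..<h} q"
    unfolding q_def
    by (intro smooth_on_sqrt smooth_on_divide smooth_on_mult smooth_on_const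
        smooth_on_subset[OF W_smooth] smooth_on_subset[OF \<kappa>(1)])
      (use l \<kappa>(2) W_pos in auto)
  have q_pos: "q x > 0" if "l < x" "x < h" for x
    using W_pos[OF that] \<kappa>(2)[of x] l that by (simp add: q_def)
  obtain u where u: "\<And>x. l < u x" "\<And>x. u x < h"
    "\<And>x. (u has_real_derivative q (u x)) (at x)"
    "(u \<longlongrightarrow> l) at_bot" "(u \<longlongrightarrow> h) at_top"
  proof (rule heteroclinic_orbit[OF lh C, of q])
    show "isCont q x" if "l < x" "x < h" for x
      using smooth_on_has_deriv[OF q_smooth, of x] that by (auto intro: DERIV_isCont)
    show "q x \<le> C * (x - l)" if "l < x" "x < h" for x
      using q_le[of x l] that by auto
    show "q x \<le> C * (h - x)" if "l < x" "x < h" for x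
      using q_le[of x h] that by auto
  qed (use q_pos in auto)
  \<comment> \<open>The sign \<open>\<sigma>\<close> treats the orbit and its reflection
    together.\<close>
  have solution: "euler_korteweg_solution r \<kappa> (\<lambda>x. density (moving_state m (v (x $ 1))))
      (\<lambda>x. velocity (moving_state m (v (x $ 1))))"
    if v: "\<And>x. l < v x" "\<And>x. v x < h" "\<And>x. (v has_real_derivative \<sigma> * q (v x)) (at x)"
      and \<sigma>: "\<sigma>\<^sup>2 = 1" for v :: "real \<Rightarrow> real" and \<sigma>
  proof -
    have dv: "deriv v x = \<sigma> * q (v x)" for x
      using v(3) by (rule DERIV_imp_deriv)
    have v_pos: "v x > 0" for x
      using v(1)[of x] l by simp
    have "stationary_profile r \<kappa> v a c m"
    proof
      show "smooth_on UNIV v"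
        using v by (intro smooth_on_autonomous_ode[of "{l<..<h}" "\<lambda>n. \<sigma> * q n" v]
            smooth_on_mult smooth_on_const q_smooth) auto
      show "deriv v x \<noteq> 0" for x
        using \<sigma> q_pos[OF v(1,2)] by (auto simp: dv less_imp_neq[symmetric])
      show "1/2 * \<kappa> (v x) * (deriv v x)\<^sup>2 = r (v x) - a * sqrt ((v x)\<^sup>2 + m\<^sup>2) + c" for x
      proof -
        have "(deriv v x)\<^sup>2 = 2 * W (v x) / \<kappa> (v x)"
          using W_pos[OF v(1,2)] \<kappa>(2)[OF v_pos] \<sigma>
          by (simp add: dv power_mult_distrib q_def less_imp_le)
        then show ?thesis
          using \<kappa>(2)[OF v_pos, of x] by (simp add: W_def)
      qed
    qed (use r \<kappa> v_pos in auto)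
    then show ?thesis
      using stationary_profile.euler_korteweg_solution_profile by fastforce
  qed
  have distinct: "moving_state m l \<noteq> moving_state m h"
    using lh by (simp add: moving_state_def)
  have "heteroclinic_solution r \<kappa> (\<lambda>s. moving_state m (u s)) (moving_state m l) (moving_state m h)"
    unfolding heteroclinic_solution_def
    using solution[of u 1] u l lh distinct by (auto intro!: tendsto_moving_state)
  then show "\<exists>w. heteroclinic_solution r \<kappa> w (moving_state m l) (moving_state m h)"
    by (rule exI[of _ "\<lambda>s. moving_state m (u s)"])
  have "((\<lambda>x. u (- x)) \<longlongrightarrow> h) at_bot"
    using u(5) by (subst filterlim_at_bot_mirror) simp
  moreover have "((\<lambda>x. u (- x)) \<longlongrightarrow> l) at_top"
    using u(4) by (subst filterlim_at_top_mirror) simp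
  moreover have "((\<lambda>x. u (- x)) has_real_derivative - 1 * q (u (- x))) (at x)" for x
    using DERIV_mirror[of u "q (u (- x))" x] u(3)[of "- x"] by simp
  ultimately have "heteroclinic_solution r \<kappa> (\<lambda>s. moving_state m (u (- s))) (moving_state m h) (moving_state m l)"
    unfolding heteroclinic_solution_def
    using solution[of "\<lambda>s. u (- s)" "- 1"] u l lh distinct
    by (auto intro!: tendsto_moving_state)
  then show "\<exists>w. heteroclinic_solution r \<kappa> w (moving_state m h) (moving_state m l)"
    by (rule exI[of _ "\<lambda>s. moving_state m (u (- s))"])
qed

subsection \<open>Common tangents\<close>

text \<open>The sign is required only in the interior, so intervals may end at \<nu>A or \<nu>B,
  where the sign of r'' is not prescribed.\<close>

lemma deriv_pos_imp_less:
  fixes f f' :: "real \<Rightarrow> real"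
  assumes "p < q" and f: "\<And>z. z \<in> {p..q} \<Longrightarrow> (f has_real_derivative f' z) (at z)"
    and pos: "\<And>z. p < z \<Longrightarrow> z < q \<Longrightarrow> 0 < f' z"
  shows "f p < f q"
proof (rule DERIV_pos_imp_increasing_open[OF \<open>p < q\<close>])
  show "\<exists>y. (f has_real_derivative y) (at z) \<and> 0 < y" if "p < z" "z < q" for z
    using f[of z] pos[of z] that by auto
  show "continuous_on {p..q} f"
    by (rule DERIV_continuous_on[OF has_field_derivative_at_within[OF f]])
qed

lemma deriv_neg_imp_less:
  fixes f f' :: "real \<Rightarrow> real"
  assumes "p < q" and f: "\<And>z. z \<in> {p..q} \<Longrightarrow> (f has_real_derivative f' z) (at z)"
    and neg: "\<And>z. p < z \<Longrightarrow> z < q \<Longrightarrow> f' z < 0"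
  shows "f q < f p"
  using deriv_pos_imp_less[OF \<open>p < q\<close>, of "\<lambda>z. - f z" "\<lambda>z. - f' z"] DERIV_minus[OF f] neg
  by simp

lemma critical_point_strict_min:
  fixes f f' :: "real \<Rightarrow> real"
  assumes S: "is_interval S"
    and f: "\<And>x. x \<in> S \<Longrightarrow> (f has_real_derivative f' x) (at x)"
    and mono: "strict_mono_on S f'"
    and p: "p \<in> S" "f' p = 0" and x: "x \<in> S" "x \<noteq> p"
  shows "f p < f x"
proof (cases "p < x")
  case True
  have S': "z \<in> S" if "p \<le> z" "z \<le> x" for z
    using S p(1) x(1) that by (meson mem_is_interval_1_I)
  show ?thesis
    by (rule deriv_pos_imp_less[OF True f])
      (use S' strict_mono_onD[OF mono p(1)] p(2) in force)+
next
  case False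
  then have less: "x < p" using x by simp
  have S': "z \<in> S" if "x \<le> z" "z \<le> p" for z
    using S p(1) x(1) that by (meson mem_is_interval_1_I)
  show ?thesis
    by (rule deriv_neg_imp_less[OF less f])
      (use S' strict_mono_onD[OF mono _ p(1)] p(2) in force)+
qed

text \<open>If \<open>f' x \<ge> 0\<close>, then \<open>f\<close> increases from \<open>p\<close> to
  \<open>x\<close>; otherwise it decreases from \<open>x\<close> to \<open>q\<close>.\<close>

lemma concave_gt_endpoints:
  fixes f f' :: "real \<Rightarrow> real"
  assumes f: "\<And>x. x \<in> {p..q} \<Longrightarrow> (f has_real_derivative f' x) (at x)"
    and anti: "strict_antimono_on {p..q} f'"
    and ends: "v < f p" "v < f q" and x: "x \<in> {p..q}"
  shows "v < f x"
proof (cases "x = p \<or> x = q")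
  case False
  then have x': "p < x" "x < q" using x by auto
  have less: "f' t < f' s" if "p \<le> s" "s < t" "t \<le> q" for s t
    using monotone_onD[OF anti, of s t] that by auto
  show ?thesis
  proof (cases "f' x \<ge> 0")
    case True
    have "0 < f' z" if "p < z" "z < x" for z
      using less[of z x] x' True that by simp
    then have "f p < f x"
      by (intro deriv_pos_imp_less[OF x'(1) f]) (use x' in auto)
    with ends show ?thesis by simp
  next
    case False
    have "f' z < 0" if "x < z" "z < q" for z
      using less[of x z] x' False that by simp
    then have "f q < f x"
      by (intro deriv_neg_imp_less[OF x'(2) f]) (use x' in auto)
    with ends show ?thesis by simp
  qed
qed (use ends in auto)

text \<open>For each fixed \<open>y\<close> the inequality is a closed condition on the pair
  \<open>(a, x)\<close>; the set is the projection of the compact set of all such pairs.\<close>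

lemma compact_common_lower_bounds:
  fixes g :: "'a::t2_space \<Rightarrow> 'b::t2_space \<Rightarrow> real"
  assumes P: "compact P" and I: "compact I"
    and cont: "continuous_on (P \<times> (I \<union> J)) (\<lambda>p. g (fst p) (snd p))"
  shows "compact {a \<in> P. \<exists>x\<in>I. \<forall>y\<in>J. g a x \<le> g a y}"
proof -
  let ?K = "P \<times> I"
  let ?C = "?K \<inter> (\<Inter>y\<in>J. {p \<in> ?K. g (fst p) (snd p) \<le> g (fst p) y})"
  have K: "compact ?K" by (rule compact_Times[OF P I])
  have "closed {p \<in> ?K. g (fst p) (snd p) \<le> g (fst p) y}" if "y \<in> J" for y
  proof (rule continuous_on_closed_Collect_le)
    show "continuous_on ?K (\<lambda>p. g (fst p) (snd p))"
      by (rule continuous_on_subset[OF cont]) auto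
    have "continuous_on ?K (\<lambda>p. (fst p, y))"
      by (intro continuous_intros)
    from continuous_on_compose2[OF cont this] that
    show "continuous_on ?K (\<lambda>p. g (fst p) y)"
      by fastforce
    show "closed ?K" by (rule compact_imp_closed[OF K])
  qed
  then have "compact ?C"
    by (intro compact_Int_closed K closed_INT) auto
  then have "compact (fst ` ?C)"
    by (intro compact_continuous_image continuous_intros)
  moreover have "fst ` ?C = {a \<in> P. \<exists>x\<in>I. \<forall>y\<in>J. g a x \<le> g a y}"
  proof (intro set_eqI iffI)
    fix a assume "a \<in> {a \<in> P. \<exists>x\<in>I. \<forall>y\<in>J. g a x \<le> g a y}"
    then obtain x where "a \<in> P" "x \<in> I" "\<And>y. y \<in> J \<Longrightarrow> g a x \<le> g a y" by blast
    then have "(a, x) \<in> ?C" by simp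
    then show "a \<in> fst ` ?C" by (rule rev_image_eqI) simp
  qed auto
  ultimately show ?thesis by simp
qed

text \<open>The parameters for which the minimum over \<open>I\<close> is at most that over \<open>J\<close>, and those for which it
  is at least that over \<open>J\<close>, are two closed sets covering the connected interval, so they meet.\<close>

lemma equal_minima:
  fixes g :: "real \<Rightarrow> 'b::t2_space \<Rightarrow> real"
  assumes I: "compact I" "I \<noteq> {}" and J: "compact J" "J \<noteq> {}" and ab: "a \<le> b"
    and cont: "continuous_on ({a..b} \<times> (I \<union> J)) (\<lambda>p. g (fst p) (snd p))"
    and lo: "\<exists>x\<in>I. \<forall>y\<in>J. g a x \<le> g a y" and hi: "\<exists>y\<in>J. \<forall>x\<in>I. g b y \<le> g b x"
  obtains t x y where "t \<in> {a..b}" "x \<in> I" "y \<in> J" "g t x = g t y"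
    "\<And>z. z \<in> I \<union> J \<Longrightarrow> g t x \<le> g t z"
proof -
  let ?A = "{t \<in> {a..b}. \<exists>x\<in>I. \<forall>y\<in>J. g t x \<le> g t y}"
  let ?B = "{t \<in> {a..b}. \<exists>y\<in>J. \<forall>x\<in>I. g t y \<le> g t x}"
  have "closed ?A"
    by (intro compact_imp_closed compact_common_lower_bounds compact_Icc I cont)
  moreover have "closed ?B"
    using cont by (intro compact_imp_closed compact_common_lower_bounds compact_Icc J)
      (simp add: Un_commute)
  moreover have minI: "\<exists>x\<in>I. \<forall>z\<in>I. g t x \<le> g t z" if "t \<in> {a..b}" for t
  proof (rule continuous_attains_inf[OF I])
    have "continuous_on I (\<lambda>z. (t, z))"
      by (intro continuous_intros)
    from continuous_on_compose2[OF cont this] that show "continuous_on I (g t)"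
      by fastforce
  qed
  moreover have minJ: "\<exists>x\<in>J. \<forall>z\<in>J. g t x \<le> g t z" if "t \<in> {a..b}" for t
  proof (rule continuous_attains_inf[OF J])
    have "continuous_on J (\<lambda>z. (t, z))"
      by (intro continuous_intros)
    from continuous_on_compose2[OF cont this] that show "continuous_on J (g t)"
      by fastforce
  qed
  moreover have "{a..b} \<subseteq> ?A \<union> ?B"
  proof
    fix t assume t: "t \<in> {a..b}"
    obtain x y where "x \<in> I" "\<forall>z\<in>I. g t x \<le> g t z" "y \<in> J" "\<forall>z\<in>J. g t y \<le> g t z"
      using minI[OF t] minJ[OF t] by blast
    then show "t \<in> ?A \<union> ?B"
      using t by (cases "g t x \<le> g t y") (force, force)
  qed
  moreover have "a \<in> ?A \<inter> {a..b}" "b \<in> ?B \<inter> {a..b}"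
    using lo hi ab by auto
  ultimately have "?A \<inter> ?B \<inter> {a..b} \<noteq> {}"
    using connected_closedD[OF connected_Icc[of a b], of ?A ?B] by blast
  then obtain t where t: "t \<in> ?A" "t \<in> ?B" by blast
  then obtain x' y' where x': "x' \<in> I" "\<And>y. y \<in> J \<Longrightarrow> g t x' \<le> g t y"
    and y': "y' \<in> J" "\<And>x. x \<in> I \<Longrightarrow> g t y' \<le> g t x" by blast
  have "t \<in> {a..b}" using t by blast
  \<comment> \<open>\<open>x'\<close> and \<open>y'\<close> are compared only with the opposite set.
    The minimisers over \<open>I\<close> and \<open>J\<close> are taken anew, and four inequalities
    force their values to agree.\<close>
  then obtain x y where x: "x \<in> I" "\<And>z. z \<in> I \<Longrightarrow> g t x \<le> g t z"
    and y: "y \<in> J" "\<And>z. z \<in> J \<Longrightarrow> g t y \<le> g t z"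
    using minI minJ by meson
  have "g t x = g t y"
    using x'(2)[OF y(1)] x(2)[OF x'(1)] y'(2)[OF x(1)] y(2)[OF y'(1)] by linarith
  with \<open>t \<in> {a..b}\<close> x y show thesis
    by (intro that[of t x y]) auto
qed

subsection \<open>The Maxwell states\<close>

lemma maxwell_states:
  assumes "barotropic_fluid r" "van_der_waals r \<nu>A \<nu>B" "dense_phase_attainable r \<nu>B"
  obtains a x y where "a > 0" "0 < x" "x < \<nu>A" "\<nu>B < y"
    "r x - a * x = r y - a * y"
    "\<And>z. z > 0 \<Longrightarrow> z \<noteq> x \<Longrightarrow> z \<noteq> y \<Longrightarrow> r x - a * x < r z - a * z"
proof -
  have smooth: "smooth_on {0<..} r"
    and r_pos: "\<And>n. n > 0 \<Longrightarrow> r n > 0" and pressure: "\<And>n. n > 0 \<Longrightarrow> r n < n * deriv r n"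
    using assms(1) smooth_on_pos_imp_smooth_on unfolding barotropic_fluid_def by auto
  have AB: "0 < \<nu>A" "\<nu>A < \<nu>B"
    and convex1: "\<And>n. 0 < n \<Longrightarrow> n < \<nu>A \<Longrightarrow> deriv (deriv r) n > 0"
    and concave: "\<And>n. \<nu>A < n \<Longrightarrow> n < \<nu>B \<Longrightarrow> deriv (deriv r) n < 0"
    and convex2: "\<And>n. \<nu>B < n \<Longrightarrow> deriv (deriv r) n > 0"
    using assms(2) unfolding van_der_waals_def by auto
  obtain d where d: "\<nu>B < d" "\<And>n. n > 0 \<Longrightarrow> r d + deriv r d * (n - d) \<le> r n"
    using assms(3) unfolding dense_phase_attainable_def by auto
  have r_deriv: "(r has_real_derivative deriv r n) (at n)" if "n > 0" for n
    using smooth_on_has_deriv[OF smooth] that by simp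
  have r_deriv2: "(deriv r has_real_derivative deriv (deriv r) n) (at n)" if "n > 0" for n
    using smooth_on_has_deriv[OF smooth_on_deriv[OF open_greaterThan smooth]] that by simp
  have tilt_deriv: "((\<lambda>n. r n - a * n) has_real_derivative deriv r n - a) (at n)" if "n > 0" for a n
    using r_deriv[OF that] by (auto intro!: derivative_eq_intros)
  have cont': "continuous_on {p..q} (deriv r)" if "p > 0" for p q
    by (rule DERIV_continuous_on[OF has_field_derivative_at_within[OF r_deriv2]]) (use that in auto)
  have cont: "continuous_on {p..q} r" if "p > 0" for p q
    by (rule DERIV_continuous_on[OF has_field_derivative_at_within[OF r_deriv]]) (use that in auto)
  have mono1: "deriv r p < deriv r q" if "0 < p" "p < q" "q \<le> \<nu>A" for p q
    by (rule deriv_pos_imp_less[OF that(2) r_deriv2 convex1]) (use that in auto)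
  have anti: "deriv r q < deriv r p" if "\<nu>A \<le> p" "p < q" "q \<le> \<nu>B" for p q
    by (rule deriv_neg_imp_less[OF that(2) r_deriv2 concave]) (use that AB in auto)
  have mono2: "deriv r p < deriv r q" if "\<nu>B \<le> p" "p < q" for p q
    by (rule deriv_pos_imp_less[OF that(2) r_deriv2 convex2]) (use that AB in auto)
  have tangent1: "r x - a * x < r z - a * z"
    if "deriv r x = a" "0 < x" "x \<le> \<nu>A" "0 < z" "z \<le> \<nu>A" "z \<noteq> x" for a x z
    by (rule critical_point_strict_min[where S = "{0<..\<nu>A}" and f' = "\<lambda>n. deriv r n - a"])
      (use that mono1 in \<open>auto intro!: tilt_deriv strict_mono_onI simp: is_interval_1\<close>)
  have tangent2: "r y - a * y < r z - a * z"
    if "deriv r y = a" "\<nu>B \<le> y" "\<nu>B \<le> z" "z \<noteq> y" for a y z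
    by (rule critical_point_strict_min[where S = "{\<nu>B..}" and f' = "\<lambda>n. deriv r n - a"])
      (use that mono2 AB in \<open>auto intro!: tilt_deriv strict_mono_onI simp: is_interval_1\<close>)
  \<comment> \<open>The pressure at \<nu>B; \<open>- p\<close> is the intercept of the tangent
    there.\<close>
  define p where "p = \<nu>B * deriv r \<nu>B - r \<nu>B"
  have p: "p > 0" using pressure[of \<nu>B] AB by (simp add: p_def)
  have d_pos: "deriv r d > 0"
    using r_pos[of d] pressure[of d] d AB by (auto simp: zero_less_mult_iff dest: less_trans)
  \<comment> \<open>Cut-off from the vacuum: for slopes up to \<open>deriv r d\<close> the tilted
    energy at \<open>e\<close> exceeds \<open>- p\<close>, whereas the common minimum will lie below
    \<open>- p\<close>.\<close>
  define e where "e = min (\<nu>A / 2) (p / deriv r d)"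
  have e: "e > 0" "e < \<nu>A" "deriv r d * e \<le> p"
    using AB p d_pos by (auto simp: e_def min_def field_simps)
  \<comment> \<open>Between \<nu>A and \<nu>B the derivative of \<open>r\<close> decreases to
    \<open>deriv r \<nu>B\<close>, so this tilt is increasing there.\<close>
  have spinodal: "r \<nu>A - deriv r \<nu>B * \<nu>A < r \<nu>B - deriv r \<nu>B * \<nu>B"
    by (rule deriv_pos_imp_less[OF AB(2) tilt_deriv]) (use anti AB in auto)
  \<comment> \<open>At slope \<open>deriv r \<nu>B\<close> the dense branch has its minimum at
    \<nu>B, above the value at \<nu>A. At slope \<open>deriv r d\<close> the tangent at
    \<open>d\<close> lies below \<open>r\<close>, so the dense branch wins. In between the minima
    balance.\<close>
  obtain a x y where axy: "a \<in> {deriv r \<nu>B..deriv r d}" "x \<in> {e..\<nu>A}" "y \<in> {\<nu>B..d}"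
    "r x - a * x = r y - a * y" "\<And>z. z \<in> {e..\<nu>A} \<union> {\<nu>B..d} \<Longrightarrow> r x - a * x \<le> r z - a * z"
  proof (rule equal_minima[of "{e..\<nu>A}" "{\<nu>B..d}" "deriv r \<nu>B" "deriv r d" "\<lambda>a n. r n - a * n"])
    show "deriv r \<nu>B \<le> deriv r d"
      using mono2[of \<nu>B d] d by simp
    have "continuous_on ({deriv r \<nu>B..deriv r d} \<times> ({e..\<nu>A} \<union> {\<nu>B..d})) (\<lambda>p. r (snd p))"
      by (rule continuous_on_compose2[OF cont[OF e(1), of d]])
        (use AB e d in \<open>auto intro: continuous_on_snd continuous_on_id\<close>)
    then show "continuous_on ({deriv r \<nu>B..deriv r d} \<times> ({e..\<nu>A} \<union> {\<nu>B..d}))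
        (\<lambda>p. r (snd p) - fst p * snd p)"
      by (intro continuous_intros)
    show "\<exists>x\<in>{e..\<nu>A}. \<forall>y\<in>{\<nu>B..d}. r x - deriv r \<nu>B * x \<le> r y - deriv r \<nu>B * y"
      using spinodal tangent2[of \<nu>B "deriv r \<nu>B"] e(2)
      by (intro bexI[of _ \<nu>A]) (force, simp)
    show "\<exists>y\<in>{\<nu>B..d}. \<forall>x\<in>{e..\<nu>A}. r y - deriv r d * y \<le> r x - deriv r d * x"
      using d e(1) by (intro bexI[of _ d]) (auto simp: algebra_simps)
  qed (use e d in auto)
  define v where "v = r x - a * x"
  have v_le: "v \<le> r z - a * z" if "z \<in> {e..\<nu>A} \<union> {\<nu>B..d}" for z
    using axy(5) that by (simp add: v_def)
  have a: "deriv r \<nu>B \<le> a" "a \<le> deriv r d" using axy(1) by auto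
  have a_pos: "a > 0"
    using r_pos[of \<nu>B] pressure[of \<nu>B] a AB by (smt (verit) zero_less_mult_iff)
  have v_neg: "v < - p"
  proof -
    have "v \<le> r \<nu>A - a * \<nu>A" using v_le[of \<nu>A] e by simp
    also have "\<dots> \<le> r \<nu>A - deriv r \<nu>B * \<nu>A" using a AB by (simp add: mult_right_mono)
    also have "\<dots> < - p" using spinodal by (simp add: p_def mult.commute)
    finally show ?thesis .
  qed
  \<comment> \<open>The slope \<open>a\<close> is attained on the dense branch by the intermediate
    value theorem, and strict convexity makes that point the only minimiser.\<close>
  have y: "deriv r y = a"
  proof -
    obtain y0 where y0: "\<nu>B \<le> y0" "y0 \<le> d" "deriv r y0 = a"
      using IVT'[of "deriv r" \<nu>B a d] a d(1) cont'[of \<nu>B d] AB by auto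
    have "y = y0"
      using tangent2[OF y0(3,1), of y] v_le[of y0] y0 axy(3,4) by (force simp: v_def)
    with y0 show ?thesis by simp
  qed
  have y_ne: "y \<noteq> \<nu>B"
  proof
    assume "y = \<nu>B"
    with y have "a = deriv r \<nu>B" by simp
    with spinodal v_le[of \<nu>A] axy(4) \<open>y = \<nu>B\<close> e show False by (simp add: v_def)
  qed
  have x_ne_e: "x \<noteq> e"
  proof
    assume "x = e"
    then have "v > - (a * e)" using r_pos[OF e(1)] by (simp add: v_def)
    moreover have "a * e \<le> p"
      using mult_right_mono[OF a(2), of e] e by linarith
    ultimately show False using v_neg by simp
  qed
  have x_ne_A: "x \<noteq> \<nu>A"
  proof
    assume xA: "x = \<nu>A"
    have "deriv r \<nu>A \<le> a"
    proof (rule ccontr)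
      assume "\<not> deriv r \<nu>A \<le> a"
      then obtain s where s: "s > 0" "\<And>h. 0 < h \<Longrightarrow> h < s \<Longrightarrow> r (\<nu>A - h) - a * (\<nu>A - h) < r \<nu>A - a * \<nu>A"
        using DERIV_pos_inc_left[OF tilt_deriv[OF AB(1), of a]] by auto
      define h where "h = min (s / 2) (\<nu>A - e)"
      have "0 < h" "h < s" "\<nu>A - h \<in> {e..\<nu>A}" using s(1) e by (auto simp: h_def min_def)
      with s(2)[of h] v_le[of "\<nu>A - h"] xA show False by (simp add: v_def)
    qed
    \<comment> \<open>\<open>deriv r\<close> falls from at most \<open>a\<close> until \<nu>B and
      then rises to \<open>a\<close> at \<open>y\<close>. The tilted energy would decrease from
      \<nu>A to \<open>y\<close>, contradicting equal minima.\<close>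
    then have lt: "deriv r z < a" if "\<nu>A < z" "z < y" for z
      using anti[of \<nu>A z] mono2[of z y] y that by (cases "z \<le> \<nu>B") auto
    have "r y - a * y < r \<nu>A - a * \<nu>A"
      by (rule deriv_neg_imp_less[OF _ tilt_deriv]) (use lt axy(3) AB in auto)
    with axy(4) xA show False by simp
  qed
  have x_int: "e < x" "x < \<nu>A" using axy(2) x_ne_e x_ne_A by auto
  have x: "deriv r x = a"
  proof -
    have "deriv r x - a = 0"
    proof (rule DERIV_local_min)
      show "((\<lambda>n. r n - a * n) has_real_derivative deriv r x - a) (at x)"
        using tilt_deriv x_int e by simp
      show "0 < min (x - e) (\<nu>A - x)" using x_int by simp
      show "\<forall>z. \<bar>x - z\<bar> < min (x - e) (\<nu>A - x) \<longrightarrow> r x - a * x \<le> r z - a * z"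
        by (intro allI impI axy(5)) (auto simp: abs_if split: if_splits)
    qed
    then show ?thesis by simp
  qed
  have outer: "v < r z - a * z" if "0 < z" "z \<noteq> x" "z \<noteq> y" "z \<le> \<nu>A \<or> \<nu>B \<le> z" for z
    using tangent1[OF x, of z] tangent2[OF y, of z] that x_int e axy(3,4) by (auto simp: v_def)
  show thesis
  proof (rule that[OF a_pos _ x_int(2) _ axy(4)])
    show "0 < x" "\<nu>B < y" using x_int e axy(3) y_ne by auto
    show "r x - a * x < r z - a * z" if z: "z > 0" "z \<noteq> x" "z \<noteq> y" for z
    proof (cases "z \<le> \<nu>A \<or> \<nu>B \<le> z")
      case True
      then show ?thesis using outer z by (simp add: v_def)
    next
      case False
      have "v < r z - a * z"
      proof (rule concave_gt_endpoints[where f = "\<lambda>n. r n - a * n" and f' = "\<lambda>n. deriv r n - a"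
            and p = \<nu>A and q = \<nu>B])
        show "strict_antimono_on {\<nu>A..\<nu>B} (\<lambda>n. deriv r n - a)"
          using anti by (intro monotone_onI) auto
        show "v < r \<nu>A - a * \<nu>A" "v < r \<nu>B - a * \<nu>B"
          using outer[of \<nu>A] outer[of \<nu>B] AB x_int axy(3) y_ne by auto
      qed (use False AB in \<open>auto intro!: tilt_deriv\<close>)
      then show ?thesis by (simp add: v_def)
    qed
  qed
qed

subsection \<open>Moving phase boundaries\<close>

lemma sqrt_sum_squares_bounds:
  fixes z m :: real
  assumes "0 \<le> z" "0 \<le> m"
  shows "z \<le> sqrt (z\<^sup>2 + m\<^sup>2)" "sqrt (z\<^sup>2 + m\<^sup>2) \<le> z + m"
proof -
  show "z \<le> sqrt (z\<^sup>2 + m\<^sup>2)"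
    by (rule real_le_rsqrt) simp
  show "sqrt (z\<^sup>2 + m\<^sup>2) \<le> z + m"
    using assms by (intro real_le_lsqrt) (auto simp: power2_sum)
qed

lemma sqrt_sum_squares_has_deriv:
  fixes z m :: real
  assumes "z > 0"
  shows "((\<lambda>z. sqrt (z\<^sup>2 + m\<^sup>2)) has_real_derivative z / sqrt (z\<^sup>2 + m\<^sup>2)) (at z)"
proof -
  have "z\<^sup>2 + m\<^sup>2 > 0" using assms by (simp add: add_pos_nonneg)
  then show ?thesis
    by (auto intro!: derivative_eq_intros simp: field_simps)
qed

text \<open>The Maxwell line of slope \<open>a0\<close> touches the energy at \<open>l\<close> and \<open>h\<close>; \<open>\<delta>\<close> and \<open>\<eta>\<close> quantify the
  convexity of the energy near the contact points and its distance to the line away from them.\<close>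

locale phase_pair =
  fixes r :: "real \<Rightarrow> real" and a0 l h d \<delta> \<eta> :: real
  assumes smooth_r: "smooth_on {0<..} r"
    and a0: "a0 > 0" and d: "d > 0" "0 < l - d" "l + d < h - d"
    and touch: "r h = r l + a0 * (h - l)"
    and tangent: "\<And>z. z > 0 \<Longrightarrow> r l + a0 * (z - l) \<le> r z"
    and \<delta>: "\<delta> > 0" "\<And>z. z \<in> {l - d..l + d} \<union> {h - d..h + d} \<Longrightarrow> \<delta> \<le> deriv (deriv r) z"
    and \<eta>: "\<eta> > 0" "\<And>z. z \<in> {l - d, h + d} \<union> {l + d..h - d} \<Longrightarrow> r l + a0 * (z - l) + \<eta> \<le> r z"
begin

text \<open>The first bound keeps slopes in [0, 2 a0]; the second limits the effect of a change of
  slope on \<open>a * z\<close> to \<open>\<eta> / 4\<close> for \<open>z\<close> up to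
  \<open>h + d\<close>.\<close>

definition \<epsilon> :: real
  where "\<epsilon> = min a0 (\<eta> / (4 * (h + d)))"

text \<open>In order, the bounds give m^2 \<le> m, keep the shift \<open>2 * a0 * m\<close> well
  below the gap \<open>\<eta>\<close>, preserve the order of the minima at the slopes
  \<open>a0 - \<epsilon>\<close> and \<open>a0 + \<epsilon>\<close>, and preserve convexity near the
  contact points.\<close>

definition m_max :: real
  where "m_max = min (min 1 (\<eta> / (16 * a0))) (min (\<epsilon> * (h - l - d) / (2 * a0)) (\<delta> * (l - d) ^ 3 / (4 * a0)))"

definition tilt :: "real \<Rightarrow> real \<Rightarrow> real \<Rightarrow> real"
  where "tilt m a z = r z - a * sqrt (z\<^sup>2 + m\<^sup>2)"

text \<open>Minimality is demanded only over the two closed intervals, which keeps the condition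
  closed; the region between them is recovered from the gap \<open>\<eta>\<close>.\<close>

definition contact :: "real \<Rightarrow> real \<Rightarrow> real \<Rightarrow> real \<Rightarrow> bool"
  where "contact m a x y \<longleftrightarrow> a \<in> {a0 - \<epsilon>..a0 + \<epsilon>} \<and> x \<in> {l - d..l + d} \<and> y \<in> {h - d..h + d} \<and>
    tilt m a x = tilt m a y \<and> (\<forall>z\<in>{l - d..l + d} \<union> {h - d..h + d}. tilt m a x \<le> tilt m a z)"

lemma \<epsilon>: "\<epsilon> > 0" "\<epsilon> \<le> a0" "\<epsilon> * (h + d) \<le> \<eta> / 4"
proof -
  have hd: "h + d > 0" using d by simp
  then show "\<epsilon> > 0" "\<epsilon> \<le> a0"
    using a0 \<eta>(1) by (simp_all add: \<epsilon>_def)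
  have cancel: "\<eta> / (4 * s) * s = \<eta> / 4" if "s > 0" for s
    using that by simp
  have "\<epsilon> * (h + d) \<le> \<eta> / (4 * (h + d)) * (h + d)"
    using hd by (intro mult_right_mono) (auto simp: \<epsilon>_def)
  then show "\<epsilon> * (h + d) \<le> \<eta> / 4"
    unfolding cancel[OF hd] .
qed

lemma m_max_pos: "m_max > 0"
  using a0 \<epsilon>(1) \<eta>(1) \<delta>(1) d by (simp add: m_max_def)

lemma m_max_bounds:
  assumes "m \<le> m_max"
  shows "m \<le> 1" "2 * a0 * m \<le> \<eta> / 8" "2 * a0 * m \<le> \<epsilon> * (h - l - d)" "2 * a0 * m \<le> \<delta> * (l - d) ^ 3 / 2"
proof -
  have "m \<le> 1" "m \<le> \<eta> / (16 * a0)" "m \<le> \<epsilon> * (h - l - d) / (2 * a0)" "m \<le> \<delta> * (l - d) ^ 3 / (4 * a0)"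
    using assms by (auto simp: m_max_def)
  then show "m \<le> 1" "2 * a0 * m \<le> \<eta> / 8" "2 * a0 * m \<le> \<epsilon> * (h - l - d)" "2 * a0 * m \<le> \<delta> * (l - d) ^ 3 / 2"
    using a0 by (simp_all add: field_simps)
qed

lemma slope_bounds:
  assumes "a \<in> {a0 - \<epsilon>..a0 + \<epsilon>}"
  shows "0 \<le> a" "a \<le> 2 * a0" "\<bar>a0 - a\<bar> \<le> \<epsilon>"
  using assms \<epsilon>(2) by auto

lemma slope_mult_le:
  assumes "a \<in> {a0 - \<epsilon>..a0 + \<epsilon>}" "0 \<le> m"
  shows "a * m \<le> 2 * a0 * m"
  using slope_bounds(2)[OF assms(1)] assms(2) by (intro mult_right_mono)

text \<open>The square root lies between \<open>z\<close> and \<open>z + m\<close>, so motion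
  perturbs the linear tilt by at most \<open>2 * a0 * m\<close>, uniformly in the slope.\<close>

lemma tilt_bounds:
  assumes "a \<in> {a0 - \<epsilon>..a0 + \<epsilon>}" "0 \<le> m" "z > 0"
  shows "r z - a * z - 2 * a0 * m \<le> tilt m a z" "tilt m a z \<le> r z - a * z"
proof -
  have "a * sqrt (z\<^sup>2 + m\<^sup>2) \<le> a * (z + m)" "a * z \<le> a * sqrt (z\<^sup>2 + m\<^sup>2)"
    using slope_bounds(1)[OF assms(1)] sqrt_sum_squares_bounds[of z m] assms
    by (auto intro!: mult_left_mono)
  then show "r z - a * z - 2 * a0 * m \<le> tilt m a z" "tilt m a z \<le> r z - a * z"
    using slope_mult_le[OF assms(1,2)] by (auto simp: tilt_def algebra_simps)
qed

lemma continuous_on_tilt: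
  "continuous_on {p. snd (snd p) > 0} (\<lambda>p. tilt (fst p) (fst (snd p)) (snd (snd p)))"
proof -
  have "continuous_on {p :: real \<times> real \<times> real. snd (snd p) > 0} (\<lambda>p. r (snd (snd p)))"
    by (rule continuous_on_compose2[OF smooth_on_imp_continuous_on[OF smooth_r]])
      (auto intro!: continuous_on_snd continuous_on_id)
  then show ?thesis
    unfolding tilt_def by (intro continuous_intros)
qed

text \<open>Relative to the Maxwell line, lowering the slope by \<open>\<epsilon>\<close> favours
  \<open>l\<close> over the right interval by at least \<open>\<epsilon> * (h - l - d)\<close>, and
  raising it favours \<open>h\<close> over the left one. This margin covers the error from
  \<open>m\<close>, so \<open>equal_minima\<close> applies.\<close>

lemma contact_exists:
  assumes m: "m \<in> {0..m_max}"
  shows "\<exists>a x y. contact m a x y"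
proof (rule equal_minima[of "{l - d..l + d}" "{h - d..h + d}" "a0 - \<epsilon>" "a0 + \<epsilon>" "tilt m"])
  have m': "0 \<le> m" "2 * a0 * m \<le> \<epsilon> * (h - l - d)"
    using m m_max_bounds[of m] by auto
  have ends: "a0 - \<epsilon> \<in> {a0 - \<epsilon>..a0 + \<epsilon>}" "a0 + \<epsilon> \<in> {a0 - \<epsilon>..a0 + \<epsilon>}"
    using \<epsilon>(1) by auto
  have pos: "l > 0" "h > 0" using d by auto
  have "tilt m (a0 - \<epsilon>) l \<le> tilt m (a0 - \<epsilon>) y" if y: "y \<in> {h - d..h + d}" for y
  proof -
    have y': "y > 0" "h - l - d \<le> y - l" using y d by auto
    have "\<epsilon> * (h - l - d) \<le> \<epsilon> * (y - l)"
      using y' \<epsilon>(1) by (intro mult_left_mono) auto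
    then have "r l - (a0 - \<epsilon>) * l \<le> r y - (a0 - \<epsilon>) * y - 2 * a0 * m"
      using tangent[OF y'(1)] m'(2) by (simp add: algebra_simps)
    then show ?thesis
      using tilt_bounds(2)[OF ends(1) m'(1) pos(1)] tilt_bounds(1)[OF ends(1) m'(1) y'(1)] by linarith
  qed
  then show "\<exists>x\<in>{l - d..l + d}. \<forall>y\<in>{h - d..h + d}. tilt m (a0 - \<epsilon>) x \<le> tilt m (a0 - \<epsilon>) y"
    using d by (intro bexI[of _ l]) auto
  have "tilt m (a0 + \<epsilon>) h \<le> tilt m (a0 + \<epsilon>) x" if x: "x \<in> {l - d..l + d}" for x
  proof -
    have x': "x > 0" "h - l - d \<le> h - x" using x d by auto
    have "\<epsilon> * (h - l - d) \<le> \<epsilon> * (h - x)"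
      using x' \<epsilon>(1) by (intro mult_left_mono) auto
    then have "r h - (a0 + \<epsilon>) * h \<le> r x - (a0 + \<epsilon>) * x - 2 * a0 * m"
      using tangent[OF x'(1)] m'(2) touch by (simp add: algebra_simps)
    then show ?thesis
      using tilt_bounds(2)[OF ends(2) m'(1) pos(2)] tilt_bounds(1)[OF ends(2) m'(1) x'(1)] by linarith
  qed
  then show "\<exists>y\<in>{h - d..h + d}. \<forall>x\<in>{l - d..l + d}. tilt m (a0 + \<epsilon>) y \<le> tilt m (a0 + \<epsilon>) x"
    using d by (intro bexI[of _ h]) auto
  let ?S = "{a0 - \<epsilon>..a0 + \<epsilon>} \<times> ({l - d..l + d} \<union> {h - d..h + d})"
  have "continuous_on ?S (\<lambda>p. (m, p))"
    by (intro continuous_intros)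
  from continuous_on_compose2[OF continuous_on_tilt this]
  show "continuous_on ?S (\<lambda>p. tilt m (fst p) (snd p))"
    using d by fastforce
next
  fix a x y
  assume "a \<in> {a0 - \<epsilon>..a0 + \<epsilon>}" "x \<in> {l - d..l + d}" "y \<in> {h - d..h + d}" "tilt m a x = tilt m a y"
    "\<And>z. z \<in> {l - d..l + d} \<union> {h - d..h + d} \<Longrightarrow> tilt m a x \<le> tilt m a z"
  then show ?thesis unfolding contact_def by blast
qed (use d \<epsilon>(1) in auto)

section \<open>Convexity of the tilted energy near the contact points\<close>

definition tilt' :: "real \<Rightarrow> real \<Rightarrow> real \<Rightarrow> real"
  where "tilt' m a z = deriv r z - a * (z / sqrt (z\<^sup>2 + m\<^sup>2))"

lemma tilt_has_deriv:
  assumes "z > 0"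
  shows "(tilt m a has_real_derivative tilt' m a z) (at z)"
proof -
  show ?thesis
    unfolding tilt_def[abs_def] tilt'_def
    using smooth_on_has_deriv[OF smooth_r, of z] assms
    by (intro DERIV_diff DERIV_cmult sqrt_sum_squares_has_deriv) auto
qed

lemma tilt'_has_deriv:
  assumes "z > 0"
  shows "(tilt' m a has_real_derivative deriv (deriv r) z - a * (m\<^sup>2 / sqrt (z\<^sup>2 + m\<^sup>2) ^ 3)) (at z)"
proof -
  define f where "f = sqrt (z\<^sup>2 + m\<^sup>2)"
  have pos: "z\<^sup>2 + m\<^sup>2 > 0" using assms by (simp add: add_pos_nonneg)
  then have f: "f > 0" "f\<^sup>2 = z\<^sup>2 + m\<^sup>2" by (simp_all add: f_def)
  have ne: "sqrt (z\<^sup>2 + m\<^sup>2) \<noteq> 0" using f(1) unfolding f_def by linarith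
  have "((\<lambda>z. z / sqrt (z\<^sup>2 + m\<^sup>2)) has_real_derivative
      (1 * sqrt (z\<^sup>2 + m\<^sup>2) - z * (z / sqrt (z\<^sup>2 + m\<^sup>2))) / (sqrt (z\<^sup>2 + m\<^sup>2) * sqrt (z\<^sup>2 + m\<^sup>2))) (at z)"
    by (rule DERIV_divide[OF DERIV_ident sqrt_sum_squares_has_deriv[OF assms] ne])
  also have "(1 * sqrt (z\<^sup>2 + m\<^sup>2) - z * (z / sqrt (z\<^sup>2 + m\<^sup>2))) / (sqrt (z\<^sup>2 + m\<^sup>2) * sqrt (z\<^sup>2 + m\<^sup>2))
      = m\<^sup>2 / sqrt (z\<^sup>2 + m\<^sup>2) ^ 3"
  proof -
    have "(1 * f - z * (z / f)) / (f * f) = (f\<^sup>2 - z\<^sup>2) / f ^ 3"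
      using f(1) by (simp add: field_simps power2_eq_square power3_eq_cube)
    then show ?thesis using f(2) by (simp add: f_def)
  qed
  finally show ?thesis
    unfolding tilt'_def[abs_def]
    using smooth_on_has_deriv[OF smooth_on_deriv[OF open_greaterThan smooth_r], of z] assms
    by (intro DERIV_diff DERIV_cmult) auto
qed

text \<open>The subtracted curve has second derivative at most \<open>\<delta> / 2\<close> on these
  intervals, less than the lower bound \<open>\<delta>\<close> for that of \<open>r\<close>.\<close>

lemma tilt'_strict_mono:
  assumes a: "a \<in> {a0 - \<epsilon>..a0 + \<epsilon>}" and m: "m \<in> {0..m_max}"
    and pq: "p < q" "{p..q} \<subseteq> {l - d..l + d} \<or> {p..q} \<subseteq> {h - d..h + d}"
  shows "tilt' m a p < tilt' m a q"
proof -
  have sub: "z \<in> {l - d..l + d} \<union> {h - d..h + d}" if "z \<in> {p..q}" for z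
    using pq that by blast
  have pos: "l - d \<le> z" "0 < z" if "z \<in> {p..q}" for z
    using sub[OF that] d by auto
  show ?thesis
  proof (rule deriv_pos_imp_less[OF pq(1) tilt'_has_deriv[OF pos(2)]])
    fix z assume "p < z" "z < q"
    then have z: "z \<in> {p..q}" by simp
    have "z \<le> sqrt (z\<^sup>2 + m\<^sup>2)"
      using pos(2)[OF z] m by (intro sqrt_sum_squares_bounds(1)) auto
    then have le: "l - d \<le> sqrt (z\<^sup>2 + m\<^sup>2)"
      using pos(1)[OF z] by linarith
    then have "(l - d) ^ 3 \<le> sqrt (z\<^sup>2 + m\<^sup>2) ^ 3"
      using d by (intro power_mono) auto
    then have "m\<^sup>2 / sqrt (z\<^sup>2 + m\<^sup>2) ^ 3 \<le> m\<^sup>2 / (l - d) ^ 3"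
      using d(2) less_le_trans[OF d(2) le]
      by (intro divide_left_mono mult_pos_pos zero_less_power) auto
    also have "\<dots> \<le> m / (l - d) ^ 3"
      using m m_max_bounds(1)[of m] d
      by (intro divide_right_mono) (auto simp: power2_eq_square mult_left_le)
    finally have "a * (m\<^sup>2 / sqrt (z\<^sup>2 + m\<^sup>2) ^ 3) \<le> a * (m / (l - d) ^ 3)"
      using slope_bounds(1)[OF a] by (rule mult_left_mono)
    also have "\<dots> \<le> 2 * a0 * m / (l - d) ^ 3"
      using slope_mult_le[OF a, of m] m d by (simp add: divide_right_mono)
    also have "\<dots> \<le> \<delta> / 2"
      using m_max_bounds(4)[of m] m d by (simp add: pos_divide_le_eq)
    also have "\<dots> < deriv (deriv r) z"
      using \<delta>(1) \<delta>(2)[OF sub[OF z]] by linarith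
    finally show "0 < deriv (deriv r) z - a * (m\<^sup>2 / sqrt (z\<^sup>2 + m\<^sup>2) ^ 3)" by simp
  qed
qed

section \<open>Properties of a contact pair\<close>

context
  fixes m a x y
  assumes m: "m \<in> {0..m_max}" and contact: "contact m a x y"
begin

lemma contact_slope: "a \<in> {a0 - \<epsilon>..a0 + \<epsilon>}"
  and contact_le: "z \<in> {l - d..l + d} \<union> {h - d..h + d} \<Longrightarrow> tilt m a x \<le> tilt m a z"
  and contact_eq: "tilt m a x = tilt m a y"
  using contact by (auto simp: contact_def)

text \<open>Comparison through \<open>l\<close>: the gap \<open>\<eta>\<close> loses at most
  \<open>\<eta> / 4\<close> at each of \<open>l\<close> and \<open>z\<close> from the change of
  slope, and \<open>\<eta> / 8\<close> from the motion.\<close>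

lemma contact_gap:
  assumes z: "z \<in> {l - d, h + d} \<union> {l + d..h - d}"
  shows "tilt m a x < tilt m a z"
proof -
  have m': "0 \<le> m" "2 * a0 * m \<le> \<eta> / 8" using m m_max_bounds(2)[of m] by auto
  have z': "0 < z" "z \<le> h + d" and l': "0 < l" "l \<le> h + d" using z d by auto
  have small: "(a0 - a) * s \<le> \<eta> / 4" "- (\<eta> / 4) \<le> (a0 - a) * s" if "0 < s" "s \<le> h + d" for s
  proof -
    have "\<bar>(a0 - a) * s\<bar> \<le> \<epsilon> * (h + d)"
      unfolding abs_mult using slope_bounds(3)[OF contact_slope] that by (intro mult_mono) auto
    with \<epsilon>(3) show "(a0 - a) * s \<le> \<eta> / 4" "- (\<eta> / 4) \<le> (a0 - a) * s" by linarith+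
  qed
  have "tilt m a x \<le> tilt m a l" using contact_le[of l] d by simp
  also have "\<dots> \<le> r l - a * l" by (rule tilt_bounds(2)[OF contact_slope m'(1) l'(1)])
  also have "\<dots> < r z - a * z - 2 * a0 * m"
    using \<eta>(2)[OF z] small(2)[OF z'] small(1)[OF l'] m'(2) \<eta>(1) by (simp add: algebra_simps)
  also have "\<dots> \<le> tilt m a z" by (rule tilt_bounds(1)[OF contact_slope m'(1) z'(1)])
  finally show ?thesis .
qed

lemma contact_interior: "l - d < x" "x < l + d" "h - d < y" "y < h + d"
proof -
  have ne: "x \<noteq> z" "y \<noteq> z" if "z \<in> {l - d, h + d} \<union> {l + d..h - d}" for z
    using contact_gap[OF that] contact_eq by auto
  have "x \<noteq> l - d" "x \<noteq> l + d" "y \<noteq> h - d" "y \<noteq> h + d"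
    using d by (auto intro!: ne)
  then show "l - d < x" "x < l + d" "h - d < y" "y < h + d"
    using contact by (auto simp: contact_def)
qed

lemma contact_critical: "tilt' m a x = 0" "tilt' m a y = 0"
proof -
  have critical: "tilt' m a p = 0"
    if "s < p" "p < t" "0 < p" "\<And>z. z \<in> {s..t} \<Longrightarrow> tilt m a p \<le> tilt m a z" for p s t
  proof (rule DERIV_local_min[OF tilt_has_deriv[OF that(3)]])
    show "0 < min (p - s) (t - p)" using that by simp
    show "\<forall>z. \<bar>p - z\<bar> < min (p - s) (t - p) \<longrightarrow> tilt m a p \<le> tilt m a z"
      by (intro allI impI that(4)) (auto simp: abs_if split: if_splits)
  qed
  show "tilt' m a x = 0"
    by (rule critical[OF contact_interior(1,2)]) (use contact_interior d contact_le in auto)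
  show "tilt' m a y = 0"
    by (rule critical[OF contact_interior(3,4)])
      (use contact_interior d contact_le contact_eq in auto)
qed

lemma contact_less:
  assumes "z \<in> {l - d..l + d} \<union> {h - d..h + d}" "z \<noteq> x" "z \<noteq> y"
  shows "tilt m a x < tilt m a z"
proof (cases "z \<in> {l - d..l + d}")
  case True
  show ?thesis
  proof (rule critical_point_strict_min[where S = "{l - d..l + d}" and f = "tilt m a" and f' = "tilt' m a"])
    show "strict_mono_on {l - d..l + d} (tilt' m a)"
      by (intro strict_mono_onI tilt'_strict_mono contact_slope m) auto
  qed (use True assms contact_interior contact_critical d in
      \<open>auto intro!: tilt_has_deriv\<close>)
next
  case False
  have "tilt m a y < tilt m a z"
  proof (rule critical_point_strict_min[where S = "{h - d..h + d}" and f = "tilt m a" and f' = "tilt' m a"])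
    show "strict_mono_on {h - d..h + d} (tilt' m a)"
      by (intro strict_mono_onI tilt'_strict_mono contact_slope m) auto
  qed (use False assms contact_interior contact_critical d in
      \<open>auto intro!: tilt_has_deriv\<close>)
  then show ?thesis by (simp add: contact_eq)
qed

text \<open>Positivity of the potential between its two wells: by the gap in the middle, by
  convexity near the ends.\<close>

lemma contact_less_between:
  assumes "x < z" "z < y"
  shows "tilt m a x < tilt m a z"
proof (cases "z \<in> {l + d..h - d}")
  case True
  then show ?thesis by (intro contact_gap) simp
next
  case False
  then show ?thesis using assms contact_interior by (intro contact_less) auto
qed

end

text \<open>Raising the slope lowers the minimum near \<open>h\<close> faster than the one near \<open>l\<close>, so equality of the
  two minima determines the slope.\<close>

lemma contact_slope_le:
  assumes m: "m \<in> {0..m_max}" and c: "contact m a x y" "contact m a' x' y'"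
  shows "a' \<le> a"
proof (rule ccontr)
  assume less: "\<not> a' \<le> a"
  let ?f = "\<lambda>z. sqrt (z\<^sup>2 + m\<^sup>2)"
  have shift: "tilt m a' z = tilt m a z - (a' - a) * ?f z" for z
    by (simp add: tilt_def algebra_simps)
  have "0 < x'" "x' < y"
    using contact_interior[OF m c(1)] contact_interior[OF m c(2)] d by auto
  then have "?f x' < ?f y"
    by (intro real_sqrt_less_mono add_strict_right_mono power_strict_mono) auto
  then have "(a' - a) * ?f x' < (a' - a) * ?f y"
    using less by (intro mult_strict_left_mono) auto
  moreover have "tilt m a y \<le> tilt m a x'"
    using contact_le[OF m c(1), of x'] contact_eq[OF m c(1)] contact_interior[OF m c(2)] by auto
  moreover have "tilt m a' x' \<le> tilt m a' y"
    using contact_le[OF m c(2), of y] contact_interior[OF m c(1)] by auto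
  ultimately show False unfolding shift by linarith
qed

text \<open>\<open>contact_slope_le\<close> in both directions equates the slopes. Then all four
  points have the same minimal value, which on each interval is attained only once.\<close>

lemma contact_unique:
  assumes m: "m \<in> {0..m_max}" and c: "contact m a x y" "contact m a' x' y'"
  shows "a = a' \<and> x = x' \<and> y = y'"
proof -
  have a: "a = a'"
    using contact_slope_le[OF m c] contact_slope_le[OF m c(2,1)] by simp
  note int = contact_interior[OF m c(1)] contact_interior[OF m c(2)]
  have "tilt m a x' \<le> tilt m a x"
    using contact_le[OF m c(2), of x] int a by auto
  then have "x = x'"
    using contact_less[OF m c(1), of x'] int d by (cases "x' = x") auto
  moreover have "tilt m a y' \<le> tilt m a x"
    using contact_le[OF m c(2), of x] contact_eq[OF m c(2)] int a by auto
  then have "y = y'"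
    using contact_less[OF m c(1), of y'] int d by (cases "y' = y") auto
  ultimately show ?thesis using a by simp
qed

section \<open>Continuous dependence of the contact points on \<open>m\<close>\<close>

lemma closed_contact: "closed {(m, a, x, y). m \<in> {0..m_max} \<and> contact m a x y}"
proof -
  let ?I = "{l - d..l + d}" and ?J = "{h - d..h + d}"
  let ?K = "{0..m_max} \<times> {a0 - \<epsilon>..a0 + \<epsilon>} \<times> ?I \<times> ?J"
  have K: "closed ?K" by (intro closed_Times closed_atLeastAtMost)
  have cont: "continuous_on ?K (\<lambda>p. tilt (fst p) (fst (snd p)) (k (snd (snd p))))"
    if "continuous_on (?I \<times> ?J) k" "\<And>q. q \<in> ?I \<times> ?J \<Longrightarrow> k q > 0" for k
  proof -
    have "continuous_on ?K (\<lambda>p. k (snd (snd p)))"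
      by (rule continuous_on_compose2[OF that(1)]) (auto intro!: continuous_on_snd continuous_on_id)
    then have "continuous_on ?K (\<lambda>p. (fst p, fst (snd p), k (snd (snd p))))"
      by (intro continuous_intros)
    from continuous_on_compose2[OF continuous_on_tilt this] that(2) show ?thesis
      by fastforce
  qed
  have cont_x: "continuous_on ?K (\<lambda>p. tilt (fst p) (fst (snd p)) (fst (snd (snd p))))"
    by (rule cont) (use d in \<open>auto intro: continuous_on_fst continuous_on_snd continuous_on_id\<close>)
  have cont_y: "continuous_on ?K (\<lambda>p. tilt (fst p) (fst (snd p)) (snd (snd (snd p))))"
    by (rule cont) (use d in \<open>auto intro: continuous_on_fst continuous_on_snd continuous_on_id\<close>)
  \<comment> \<open>One inequality between the two values is enough: minimality at
    \<open>z = y\<close> supplies the other.\<close>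
  let ?C = "{p \<in> ?K. tilt (fst p) (fst (snd p)) (snd (snd (snd p))) \<le> tilt (fst p) (fst (snd p)) (fst (snd (snd p)))}
    \<inter> (\<Inter>z\<in>?I \<union> ?J. {p \<in> ?K. tilt (fst p) (fst (snd p)) (fst (snd (snd p))) \<le> tilt (fst p) (fst (snd p)) z})"
  have "closed {p \<in> ?K. tilt (fst p) (fst (snd p)) (fst (snd (snd p))) \<le> tilt (fst p) (fst (snd p)) z}"
    if "z \<in> ?I \<union> ?J" for z
    using that d by (intro continuous_on_closed_Collect_le cont_x K cont continuous_on_const) auto
  then have "closed ?C"
    by (intro closed_Int closed_INT continuous_on_closed_Collect_le cont_x cont_y K) auto
  moreover have "?C = {(m, a, x, y). m \<in> {0..m_max} \<and> contact m a x y}"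
  proof (intro set_eqI)
    fix p :: "real \<times> real \<times> real \<times> real"
    obtain m a x y where p: "p = (m, a, x, y)" by (cases p)
    have "p \<in> ?C \<longleftrightarrow> m \<in> {0..m_max} \<and> a \<in> {a0 - \<epsilon>..a0 + \<epsilon>} \<and> x \<in> ?I \<and> y \<in> ?J \<and>
        tilt m a y \<le> tilt m a x \<and> (\<forall>z\<in>?I \<union> ?J. tilt m a x \<le> tilt m a z)"
      using d unfolding p by fastforce
    also have "\<dots> \<longleftrightarrow> m \<in> {0..m_max} \<and> contact m a x y"
      unfolding contact_def by (metis UnI2 order_antisym order_refl)
    finally show "p \<in> ?C \<longleftrightarrow> p \<in> {(m, a, x, y). m \<in> {0..m_max} \<and> contact m a x y}"
      unfolding p by simp
  qed
  ultimately show ?thesis by simp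
qed

lemma contact_family:
  obtains A X Y where "\<And>m. m \<in> {0..m_max} \<Longrightarrow> contact m (A m) (X m) (Y m)"
    "continuous_on {0..m_max} X" "continuous_on {0..m_max} Y"
proof -
  obtain \<tau> where \<tau>: "\<And>m. m \<in> {0..m_max} \<Longrightarrow> contact m (fst (\<tau> m)) (fst (snd (\<tau> m))) (snd (snd (\<tau> m)))"
  proof -
    have "\<forall>m\<in>{0..m_max}. \<exists>t. contact m (fst t) (fst (snd t)) (snd (snd t))"
      using contact_exists by fastforce
    then show thesis using that by (metis bchoice)
  qed
  let ?T = "{a0 - \<epsilon>..a0 + \<epsilon>} \<times> {l - d..l + d} \<times> {h - d..h + d}"
  \<comment> \<open>A map into a compact set is continuous if its graph is closed; uniqueness
    identifies the graph of the chosen \<open>\<tau>\<close> with the closed contact set.\<close>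
  have "continuous_on {0..m_max} \<tau>"
  proof (rule continuous_from_closed_graph[of ?T])
    show "compact ?T" by (intro compact_Times compact_Icc)
    show "\<tau> \<in> {0..m_max} \<rightarrow> ?T"
      using \<tau> by (auto simp: contact_def mem_Times_iff)
    have "(\<lambda>m. (m, \<tau> m)) ` {0..m_max} = {(m, a, x, y). m \<in> {0..m_max} \<and> contact m a x y}"
    proof (intro set_eqI iffI)
      fix p assume "p \<in> {(m, a, x, y). m \<in> {0..m_max} \<and> contact m a x y}"
      then obtain m a x y where p: "p = (m, a, x, y)" "m \<in> {0..m_max}" "contact m a x y" by auto
      then have "\<tau> m = (a, x, y)"
        using contact_unique[OF p(2) \<tau>[OF p(2)] p(3)] by (simp add: prod_eq_iff)
      with p show "p \<in> (\<lambda>m. (m, \<tau> m)) ` {0..m_max}" by auto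
    qed (use \<tau> in \<open>auto simp: case_prod_beta\<close>)
    then show "closed ((\<lambda>m. (m, \<tau> m)) ` {0..m_max})"
      using closed_contact by simp
  qed
  note continuous_on_snd[OF this]
  then have "continuous_on {0..m_max} (\<lambda>m. fst (snd (\<tau> m)))"
    "continuous_on {0..m_max} (\<lambda>m. snd (snd (\<tau> m)))"
    by (rule continuous_on_fst, rule continuous_on_snd)
  show thesis
  proof (rule that[of "\<lambda>m. fst (\<tau> m)" "\<lambda>m. fst (snd (\<tau> m))" "\<lambda>m. snd (snd (\<tau> m))"])
    show "contact m (fst (\<tau> m)) (fst (snd (\<tau> m))) (snd (snd (\<tau> m)))" if "m \<in> {0..m_max}" for m
      by (rule \<tau>[OF that])
  qed fact+
qed

end

section \<open>From the Maxwell states to a phase pair\<close>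

lemma van_der_waals_phase_pair:
  assumes "barotropic_fluid r" "van_der_waals r \<nu>A \<nu>B" "dense_phase_attainable r \<nu>B"
  shows "\<exists>a0 l h d \<delta> \<eta>. phase_pair r a0 l h d \<delta> \<eta>"
proof -
  obtain a x y where a: "a > 0" and xy: "0 < x" "x < \<nu>A" "\<nu>B < y"
    and eq: "r x - a * x = r y - a * y"
    and less: "\<And>z. z > 0 \<Longrightarrow> z \<noteq> x \<Longrightarrow> z \<noteq> y \<Longrightarrow> r x - a * x < r z - a * z"
    by (rule maxwell_states[OF assms], rule that)
  have smooth: "smooth_on {0<..} r"
    using assms(1) smooth_on_pos_imp_smooth_on unfolding barotropic_fluid_def by auto
  have AB: "\<nu>A < \<nu>B"
    and convex: "\<And>n. 0 < n \<Longrightarrow> n < \<nu>A \<or> \<nu>B < n \<Longrightarrow> deriv (deriv r) n > 0"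
    using assms(2) unfolding van_der_waals_def by auto
  \<comment> \<open>Half the distances to 0, \<nu>A and \<nu>B keep both intervals inside the convex
    branches. Compactness then provides \<open>\<delta>\<close> as a minimum of r'' and
    \<open>\<eta>\<close> as the least gap above the Maxwell line.\<close>
  define d where "d = min (x / 2) (min ((\<nu>A - x) / 2) ((y - \<nu>B) / 2))"
  have d: "d > 0" "d < x" "x + d < \<nu>A" "\<nu>B < y - d"
    using xy by (auto simp: d_def min_def field_simps)
  let ?I = "{x - d..x + d} \<union> {y - d..y + d}" and ?K = "{x - d, y + d} \<union> {x + d..y - d}"
  have "\<exists>z0\<in>?I. \<forall>z\<in>?I. deriv (deriv r) z0 \<le> deriv (deriv r) z"
  proof (rule continuous_attains_inf)
    show "continuous_on ?I (deriv (deriv r))"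
      by (rule continuous_on_subset[OF smooth_on_imp_continuous_on
            [OF smooth_on_deriv[OF open_greaterThan smooth_on_deriv[OF open_greaterThan smooth]]]])
        (use d AB xy in auto)
  qed (use d in auto)
  then obtain z0 where z0: "z0 \<in> ?I" "\<And>z. z \<in> ?I \<Longrightarrow> deriv (deriv r) z0 \<le> deriv (deriv r) z"
    by blast
  have z0_pos: "deriv (deriv r) z0 > 0"
    using z0(1) d AB xy by (intro convex) auto
  have "\<exists>z1\<in>?K. \<forall>z\<in>?K. r z1 - a * z1 \<le> r z - a * z"
  proof (rule continuous_attains_inf)
    have "smooth_on {0<..} (\<lambda>z. r z - a * z)"
      by (intro smooth_on_diff smooth_on_mult smooth_on_const smooth_on_id smooth)
    then show "continuous_on ?K (\<lambda>z. r z - a * z)"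
      by (rule continuous_on_subset[OF smooth_on_imp_continuous_on]) (use d AB xy in auto)
  qed auto
  then obtain z1 where z1: "z1 \<in> ?K" "\<And>z. z \<in> ?K \<Longrightarrow> r z1 - a * z1 \<le> r z - a * z"
    by blast
  have z1_gap: "r x - a * x < r z1 - a * z1"
    using z1(1) d AB xy by (intro less) auto
  have "phase_pair r a x y d (deriv (deriv r) z0) ((r z1 - a * z1) - (r x - a * x))"
  proof
    show "r x + a * (z - x) \<le> r z" if "z > 0" for z
    proof -
      have "r x - a * x \<le> r z - a * z"
        using less[OF that] eq by (cases "z = x \<or> z = y") auto
      then show ?thesis by (simp add: algebra_simps)
    qed
    show "r x + a * (z - x) + ((r z1 - a * z1) - (r x - a * x)) \<le> r z" if "z \<in> ?K" for z
      using z1(2)[OF that] by (simp add: algebra_simps)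
  qed (use smooth a d AB xy eq z0 z0_pos z1_gap in \<open>auto simp: algebra_simps\<close>)
  then show ?thesis by blast
qed

theorem theorem4p1:
  fixes r \<kappa> :: "real \<Rightarrow> real" and \<nu>A \<nu>B :: real
  assumes "barotropic_fluid r"
    and "van_der_waals r \<nu>A \<nu>B"
    and "dense_phase_attainable r \<nu>B"
    and "capillarity_coefficient \<kappa>"
  shows "\<exists>(mbar :: real) (lower :: real \<Rightarrow> state) (upper :: real \<Rightarrow> state).
    mbar > 0 \<and>
    continuous_on {0..<mbar} (\<lambda>m. (lower m, upper m)) \<and>
    inj_on (\<lambda>m. (lower m, upper m)) {0..<mbar} \<and>
    (\<forall>m\<in>{0..<mbar}.
       admissible_state (lower m) \<and> admissible_state (upper m) \<and> lower m \<noteq> upper m \<and>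
       (\<exists>forward backward :: real \<Rightarrow> state.
          heteroclinic_solution r \<kappa> forward (lower m) (upper m) \<and>
          heteroclinic_solution r \<kappa> backward (upper m) (lower m)))"
proof -
  obtain a0 l h d \<delta> \<eta> where "phase_pair r a0 l h d \<delta> \<eta>"
    using van_der_waals_phase_pair[OF assms(1-3)] by blast
  then interpret phase_pair r a0 l h d \<delta> \<eta> .
  have \<kappa>: "smooth_on {0<..} \<kappa>" "\<And>n. n > 0 \<Longrightarrow> \<kappa> n > 0"
    using assms(4) smooth_on_pos_imp_smooth_on unfolding capillarity_coefficient_def by auto
  obtain A X Y where AXY: "\<And>m. m \<in> {0..m_max} \<Longrightarrow> contact m (A m) (X m) (Y m)"
    and cont: "continuous_on {0..m_max} X" "continuous_on {0..m_max} Y"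
    by (rule contact_family, rule that)
  have XY: "0 < X m" "X m < Y m" if "m \<in> {0..<m_max}" for m
    using contact_interior[of m "A m" "X m" "Y m"] AXY[of m] that d by auto
  let ?lower = "\<lambda>m. moving_state m (X m)" and ?upper = "\<lambda>m. moving_state m (Y m)"
  have "continuous_on {0..<m_max} (\<lambda>m. (?lower m, ?upper m))"
    unfolding continuous_on_def
  proof
    fix m assume m: "m \<in> {0..<m_max}"
    have sub: "{0..<m_max} \<subseteq> {0..m_max}" by auto
    have "(X \<longlongrightarrow> X m) (at m within {0..<m_max})" "(Y \<longlongrightarrow> Y m) (at m within {0..<m_max})"
      using cont[THEN continuous_on_subset, OF sub] m unfolding continuous_on_def by blast+
    then show "((\<lambda>m. (?lower m, ?upper m)) \<longlongrightarrow> (?lower m, ?upper m)) (at m within {0..<m_max})"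
      using XY[OF m] by (intro tendsto_Pair tendsto_moving_state tendsto_ident_at) auto
  qed
  \<comment> \<open>The lower state alone determines its parameter, m = \<nu> U^1.\<close>
  moreover have "inj_on (\<lambda>m. (?lower m, ?upper m)) {0..<m_max}"
    using XY(1) by (intro inj_onI) (fastforce simp: moving_state_def)
  moreover have "admissible_state (moving_state m n)" if "n > 0" for m n
    using that mink_prod_velocity_moving_state[of m n]
    by (simp add: admissible_state_def velocity_moving_state add_pos_nonneg)
  then have "\<forall>m\<in>{0..<m_max}. admissible_state (?lower m) \<and> admissible_state (?upper m)"
    using XY by (meson less_trans)
  moreover have "\<forall>m\<in>{0..<m_max}. ?lower m \<noteq> ?upper m"
    using XY(2) by (fastforce simp: moving_state_def)
  moreover have "(\<exists>w. heteroclinic_solution r \<kappa> w (?lower m) (?upper m)) \<and>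
      (\<exists>w. heteroclinic_solution r \<kappa> w (?upper m) (?lower m))" if "m \<in> {0..<m_max}" for m
  proof -
    have m: "m \<in> {0..m_max}" using that by simp
    note c = AXY[OF m]
    \<comment> \<open>Normalises the potential to vanish at both contact points; this is the
      momentum flux of the profile.\<close>
    let ?c = "- tilt m (A m) (X m)"
    let ?W = "\<lambda>n. r n - A m * sqrt (n\<^sup>2 + m\<^sup>2) + ?c"
    have "deriv ?W n = tilt' m (A m) n" if "n > 0" for n
      using DERIV_add[OF tilt_has_deriv[OF that] DERIV_const[of ?c], of m "A m"]
      by (intro DERIV_imp_deriv) (simp add: tilt_def)
    then have "deriv ?W (X m) = 0" "deriv ?W (Y m) = 0"
      using contact_critical[OF m c] XY[OF that] by auto
    moreover have "?W (X m) = 0" "?W (Y m) = 0"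
      using contact_eq[OF m c] by (auto simp: tilt_def)
    moreover have "?W n > 0" if "X m < n" "n < Y m" for n
      using contact_less_between[OF m c that] by (simp add: tilt_def)
    ultimately show ?thesis
      using heteroclinic_of_double_well[OF smooth_r \<kappa> XY[OF that], of "A m" m ?c] by blast
  qed
  ultimately show ?thesis
    using m_max_pos by (intro exI[of _ m_max] exI[of _ ?lower] exI[of _ ?upper]) blast
qed

end
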